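(* For every integer $k \ge 3$ there exists a real number $\varepsilon_k > 0$ such that for all sufficiently large integers $n$, the equality $$\mathrm{ex}(n,(t+1)C_{2k}) = \binom{n}{2}-\binom{n-k(t+1)+1}{2} + 1$$ holds for all integers $t \in \left[\frac{\mathrm{ex}(n,C_{2k})}{\varepsilon_k n},\ \varepsilon_{k} n\right]$.
   Context: All graphs are finite and simple. $C_{2k}$ denotes the cycle on $2k$ vertices. For a graph $F$, a graph $G$ is $F$-free if it contains no copy of $F$ as a (not necessarily induced) subgraph. $\mathrm{ex}(n,F)$ denotes the maximum number of edges in an $n$-vertex $F$-free graph. For an integer $t\ge 0$, $(t+1)F$ denotes the vertex-disjoint union of $t+1$ copies of $F$, so that $\mathrm{ex}(n,(t+1)F)$ is the maximum number of edges in an $n$-vertex graph containing at most $t$ pairwise vertex-disjoint copies of $F$ (as not necessarily induced subgraphs). "Sufficiently large" means: there is an integer $n_0$ depending only on $k$ (and $\varepsilon_k$) such that the conclusion holds for every $n\ge n_0$ and every integer $t$ in the stated interval. *)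

theory Defs
  imports Complex_Main "HOL-Library.Ramsey"
begin

text \<open>A graph is a pair of a vertex set and an edge set, an edge being an unordered pair of
  distinct vertices; \<open>[V]\<^bsup>2\<^esup>\<close> is the set of 2-element subsets of \<open>V\<close>.\<close>

type_synonym 'a graph = "'a set \<times> 'a set set"

abbreviation verts :: "'a graph \<Rightarrow> 'a set" where "verts \<equiv> fst"
abbreviation edges :: "'a graph \<Rightarrow> 'a set set" where "edges \<equiv> snd"

definition simple_graph :: "'a graph \<Rightarrow> bool" where
  "simple_graph G \<longleftrightarrow> finite (verts G) \<and> edges G \<subseteq> [verts G]\<^bsup>2\<^esup>"

definition contains_copy :: "'b graph \<Rightarrow> 'a graph \<Rightarrow> bool" where
  "contains_copy G F \<longleftrightarrow>
     (\<exists>f. inj_on f (verts F) \<and> f ` verts F \<subseteq> verts G \<and> (\<forall>e\<in>edges F. f ` e \<in> edges G))"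

text \<open>Vertices are taken in \<open>nat\<close>, which covers every finite graph up to isomorphism. The set
  below is always finite; it is nonempty as soon as \<open>F\<close> has an edge.\<close>

definition ex_number :: "nat \<Rightarrow> 'a graph \<Rightarrow> nat" where
  "ex_number n F =
     Max {card (edges G) | G :: nat graph.
            simple_graph G \<and> card (verts G) = n \<and> \<not> contains_copy G F}"

text \<open>For \<open>m \<ge> 3\<close> this is the cycle on \<open>m\<close> vertices; smaller \<open>m\<close> are not used.\<close>

definition cycle_graph :: "nat \<Rightarrow> nat graph" where
  "cycle_graph m = ({..<m}, {{i, Suc i mod m} | i. i < m})"

definition disjoint_copies :: "nat \<Rightarrow> 'a graph \<Rightarrow> (nat \<times> 'a) graph" where
  "disjoint_copies m F = ({..<m} \<times> verts F, {Pair i ` e | i e. i < m \<and> e \<in> edges F})"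

end

theory Submission imports Defs "HOL-Library.Disjoint_Sets" begin

text \<open>Put \<open>s = k(t+1) - 1\<close> and \<open>N = n - s\<close>; the claimed value is the number of pairs of
vertices that meet a fixed \<open>s\<close>-set, plus one. For the lower bound, join a clique on
\<open>s\<close> vertices to everything else and add one more edge. A \<open>2k\<close>-cycle has at most one
edge outside the \<open>s\<close>-set, so it uses at least \<open>k\<close> vertices of the
\<open>s\<close>-set (\<open>cycle_meets_cover\<close>), and \<open>t+1\<close> disjoint cycles would use
\<open>s+1\<close> of them.

For the upper bound let \<open>G\<close> have at least that many edges and no \<open>t+1\<close> disjoint
\<open>2k\<close>-cycles. The lower end of the range of \<open>t\<close> says that \<open>ex(n, C)\<close>,
where \<open>C\<close> is the \<open>2k\<close>-cycle, is small compared with \<open>tn\<close>, and taking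
disjoint copies of a \<open>C\<close>-free graph shows that \<^emph>\<open>every\<close> \<open>C\<close>-free
subgraph of \<open>G\<close> on \<open>d\<close> vertices has \<open>O(\<epsilon>td)\<close> edges
(\<open>cycle_free_sparse\<close>). The proof then has two stages.

Stability (\<open>high_degree_vertices\<close>). Among a constant number of vertices of degree at least
\<open>\<delta>n\<close>, some \<open>k\<close> have linearly many common neighbours
(\<open>popular_subset\<close>). Picking such \<open>k\<close>-sets greedily yields disjoint cycles, so there
are at most \<open>kt + O(1)\<close> vertices of degree at least \<open>\<delta>n\<close>. All other edges are
few: delete a maximal packing of cycles, at most \<open>2kt\<close> vertices of degree below
\<open>\<delta>n\<close>, and what remains is cycle-free. So nearly all of the roughly \<open>ktn\<close>
edges sit at \<open>kt + O(1)\<close> vertices, which forces almost all of these to have almost full degree.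
In particular the set \<open>A\<close> of vertices of degree at least \<open>3n/4\<close> has at least
\<open>s - r\<close> elements with \<open>r < t/4\<close>.

From stability to the exact bound (\<open>edge_bound_near_extremal\<close>). Any two vertices of
\<open>A\<close> have \<open>n/2\<close> common neighbours, so any \<open>k\<close> of them span a cycle with
\<open>k\<close> further vertices; \<open>A\<close> is short of \<open>r+1\<close> vertices for
\<open>t+1\<close> such cycles. A \<^emph>\<open>saving\<close> is a small configuration outside
\<open>A\<close> that lets one cycle use at most \<open>k-1\<close> vertices of \<open>A\<close>: a whole
cycle, or a path on three vertices or two disjoint edges whose ends are adjacent to more than three quarters
of \<open>A\<close>. This is where \<open>k \<ge> 3\<close> enters, since two disjoint edges need two vertices
of \<open>A\<close> between them. With \<open>r+1\<close> disjoint savings there are \<open>t+1\<close>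
disjoint cycles (\<open>cycles_from_savings\<close>). With at most \<open>r\<close> of them, what is left
outside \<open>A\<close> after deleting them contains at most one edge besides those at the
\<^emph>\<open>bad\<close> vertices, which miss at least a quarter of \<open>A\<close>
(\<open>edges_without_saving\<close>), and there are no more edges of the latter kind than pairs that the bad
vertices miss in \<open>A\<close>. Counting gives exactly the extremal number.\<close>

section \<open>Packings of disjoint vertex sets\<close>

text \<open>Members are required to be nonempty: then families living in disjoint sets have no common member, and
packing numbers add up.\<close>

definition packing :: "('a set \<Rightarrow> bool) \<Rightarrow> 'a set \<Rightarrow> nat \<Rightarrow> bool" where
  "packing P S m \<longleftrightarrow>
     (\<exists>\<C>. finite \<C> \<and> card \<C> = m \<and> disjoint \<C> \<and> (\<forall>C\<in>\<C>. P C \<and> C \<noteq> {} \<and> C \<subseteq> S))"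

lemma packing_0 [simp]: "packing P S 0"
  unfolding packing_def by (rule exI[of _ "{}"]) auto

lemma packing_single: "P C \<Longrightarrow> C \<noteq> {} \<Longrightarrow> packing P C 1"
  unfolding packing_def by (rule exI[of _ "{C}"]) (auto simp: disjoint_def)

lemma packing_mono: "packing P S m \<Longrightarrow> S \<subseteq> T \<Longrightarrow> packing P T m"
  unfolding packing_def by blast

lemma packing_weaken:
  assumes "packing P S m" "\<And>C. P C \<Longrightarrow> P' C"
  shows "packing P' S m"
proof -
  obtain \<C> where "finite \<C>" "card \<C> = m" "disjoint \<C>" "\<forall>C\<in>\<C>. P C \<and> C \<noteq> {} \<and> C \<subseteq> S"
    using assms(1) unfolding packing_def by blast
  then show ?thesis unfolding packing_def using assms(2) by (intro exI[of _ \<C>]) simp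
qed

lemma packing_fewer:
  assumes "packing P S m" "m' \<le> m"
  shows "packing P S m'"
proof -
  obtain \<C> where \<C>: "finite \<C>" "card \<C> = m" "disjoint \<C>" "\<forall>C\<in>\<C>. P C \<and> C \<noteq> {} \<and> C \<subseteq> S"
    using assms(1) unfolding packing_def by blast
  obtain \<D> where "\<D> \<subseteq> \<C>" "card \<D> = m'" "finite \<D>"
    using obtain_subset_with_card_n[of m' \<C>] assms(2) \<C>(2) by metis
  with \<C> show ?thesis unfolding packing_def
    by (intro exI[of _ \<D>]) (auto simp: disjoint_def pairwise_def)
qed

lemma packing_add:
  assumes "packing P S m" "packing P T m'" "S \<inter> T = {}"
  shows "packing P (S \<union> T) (m + m')"
proof -
  obtain \<C> where \<C>: "finite \<C>" "card \<C> = m" "disjoint \<C>" "\<forall>C\<in>\<C>. P C \<and> C \<noteq> {} \<and> C \<subseteq> S"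
    using assms(1) unfolding packing_def by blast
  obtain \<D> where \<D>: "finite \<D>" "card \<D> = m'" "disjoint \<D>" "\<forall>C\<in>\<D>. P C \<and> C \<noteq> {} \<and> C \<subseteq> T"
    using assms(2) unfolding packing_def by blast
  have "\<Union>\<C> \<subseteq> S" "\<Union>\<D> \<subseteq> T"
    using \<C>(4) \<D>(4) by (simp_all add: Union_least)
  then have cross: "\<Union>\<C> \<inter> \<Union>\<D> = {}"
    using assms(3) by blast
  have "\<C> \<inter> \<D> = {}"
  proof (rule ccontr)
    assume "\<C> \<inter> \<D> \<noteq> {}"
    then obtain C where C: "C \<in> \<C>" "C \<in> \<D>" by blast
    then have "C = {}" using cross by blast
    then show False using C \<C>(4) by simp
  qed
  then have "card (\<C> \<union> \<D>) = m + m'"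
    using \<C> \<D> by (simp add: card_Un_disjoint)
  moreover have "disjoint (\<C> \<union> \<D>)"
    using disjoint_union[OF \<C>(3) \<D>(3) cross] .
  ultimately show ?thesis
    unfolding packing_def using \<C>(1,4) \<D>(1,4) by (intro exI[of _ "\<C> \<union> \<D>"]) auto
qed

lemma packing_SucE:
  assumes "packing P S (Suc m)"
  obtains C T where "P C" "C \<noteq> {}" "C \<subseteq> S" "T \<subseteq> S" "C \<inter> T = {}" "packing P T m"
proof -
  obtain \<C> where \<C>: "finite \<C>" "card \<C> = Suc m" "disjoint \<C>" "\<forall>C\<in>\<C>. P C \<and> C \<noteq> {} \<and> C \<subseteq> S"
    using assms unfolding packing_def by blast
  then obtain C where C: "C \<in> \<C>" by fastforce
  have "packing P (\<Union>(\<C> - {C})) m"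
    unfolding packing_def using \<C> C
    by (intro exI[of _ "\<C> - {C}"]) (auto simp: disjoint_def)
  moreover have "C \<inter> \<Union>(\<C> - {C}) = {}"
    using \<C>(3) C unfolding disjoint_def by blast
  moreover have "P C" "C \<noteq> {}" "C \<subseteq> S" "\<Union>(\<C> - {C}) \<subseteq> S"
    using \<C>(4) C by auto
  ultimately show thesis by (intro that)
qed

text \<open>A packing of \<open>m\<close> bounded sets only occupies boundedly many vertices per member, which leaves room
for further greedy choices.\<close>

lemma packing_support:
  assumes "packing P S m" and P: "\<And>C. P C \<Longrightarrow> finite C \<and> card C \<le> c"
  shows "\<exists>W\<subseteq>S. finite W \<and> card W \<le> c * m \<and> packing P W m"
  using assms(1)
proof (induction m arbitrary: S)
  case 0
  show ?case by (intro exI[of _ "{}"]) simp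
next
  case (Suc m)
  from Suc.prems obtain C T where C: "P C" "C \<noteq> {}" "C \<subseteq> S" "T \<subseteq> S" "C \<inter> T = {}" "packing P T m"
    by (rule packing_SucE)
  obtain W where W: "W \<subseteq> T" "finite W" "card W \<le> c * m" "packing P W m"
    using Suc.IH[OF C(6)] by blast
  have "C \<inter> W = {}" using C(5) W(1) by blast
  then have "packing P (C \<union> W) (1 + m)"
    by (rule packing_add[OF packing_single[of P C] W(4), OF C(1,2)])
  moreover have "card (C \<union> W) \<le> c * Suc m"
    using card_Un_le[of C W] P[OF C(1)] W(3) by simp
  moreover have "C \<union> W \<subseteq> S" "finite (C \<union> W)" using C(3,4) W(1,2) P[OF C(1)] by auto
  ultimately show ?case by (intro exI[of _ "C \<union> W"] conjI) simp_all
qed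

text \<open>Removing the support of a maximal packing destroys all \<open>P\<close>-sets at the price of at most \<open>c\<close> vertices
per member.\<close>

lemma packing_maximal:
  assumes "finite S" and P: "\<And>C. P C \<Longrightarrow> finite C \<and> card C \<le> c"
  shows "\<exists>m W. W \<subseteq> S \<and> card W \<le> c * m \<and> packing P W m \<and> \<not> (\<exists>C. P C \<and> C \<noteq> {} \<and> C \<subseteq> S - W)"
  using assms(1)
proof (induction S rule: finite_psubset_induct)
  case (psubset S)
  show ?case
  proof (cases "\<exists>C. P C \<and> C \<noteq> {} \<and> C \<subseteq> S")
    case True
    then obtain C where C: "P C" "C \<noteq> {}" "C \<subseteq> S" by (elim exE conjE)
    then have "S - C \<subset> S" by blast
    from psubset.IH[OF this] obtain m W where W: "W \<subseteq> S - C" "card W \<le> c * m" "packing P W m"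
      "\<not> (\<exists>C'. P C' \<and> C' \<noteq> {} \<and> C' \<subseteq> S - C - W)" by (elim exE conjE)
    have "C \<inter> W = {}" using W(1) by blast
    then have "packing P (C \<union> W) (1 + m)"
      by (rule packing_add[OF packing_single[of P C] W(3), OF C(1,2)])
    moreover have "card (C \<union> W) \<le> c * (1 + m)"
      using card_Un_le[of C W] P[OF C(1)] W(2) by simp
    moreover have "S - C - W = S - (C \<union> W)" by blast
    moreover have "C \<union> W \<subseteq> S" using C(3) W(1) by blast
    ultimately show ?thesis using W(4) by metis
  next
    case False
    have "S - {} = S" by simp
    then show ?thesis using False
      by (intro exI[of _ 0] exI[of _ "{}"] conjI) simp_all
  qed
qed

section \<open>Cycles as vertex sets\<close>

text \<open>Only the vertex set of the cycle is recorded, since disjointness is the only interaction between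
cycles that matters.\<close>

definition spans_cycle :: "'a set set \<Rightarrow> nat \<Rightarrow> 'a set \<Rightarrow> bool" where
  "spans_cycle E l C \<longleftrightarrow> (\<exists>f. bij_betw f {..<l} C \<and> (\<forall>i<l. {f i, f (Suc i mod l)} \<in> E))"

lemma spans_cycle_card: "spans_cycle E l C \<Longrightarrow> finite C \<and> card C = l"
  unfolding spans_cycle_def by (metis bij_betw_finite bij_betw_same_card card_lessThan finite_lessThan)

lemma spans_cycle_nonempty: "spans_cycle E l C \<Longrightarrow> 0 < l \<Longrightarrow> C \<noteq> {}"
  using spans_cycle_card by fastforce

lemma contains_cycle_iff:
  "contains_copy (V, E) (cycle_graph l) \<longleftrightarrow> (\<exists>C\<subseteq>V. spans_cycle E l C)"
proof
  assume "contains_copy (V, E) (cycle_graph l)"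
  then obtain f where f: "inj_on f {..<l}" "f ` {..<l} \<subseteq> V"
    "\<forall>e\<in>{{i, Suc i mod l} | i. i < l}. f ` e \<in> E"
    unfolding contains_copy_def cycle_graph_def by auto
  have "{f i, f (Suc i mod l)} \<in> E" if "i < l" for i
    using f(3)[rule_format, of "{i, Suc i mod l}"] that by auto
  then show "\<exists>C\<subseteq>V. spans_cycle E l C"
    using f unfolding spans_cycle_def by (intro exI[of _ "f ` {..<l}"]) (auto simp: bij_betw_def)
next
  assume "\<exists>C\<subseteq>V. spans_cycle E l C"
  then obtain C f where "C \<subseteq> V" "bij_betw f {..<l} C" "\<forall>i<l. {f i, f (Suc i mod l)} \<in> E"
    unfolding spans_cycle_def by blast
  then show "contains_copy (V, E) (cycle_graph l)"
    unfolding contains_copy_def cycle_graph_def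
    by (intro exI[of _ f]) (auto simp: bij_betw_def)
qed

lemma contains_disjoint_cycles_iff:
  assumes "0 < l"
  shows "contains_copy (V, E) (disjoint_copies m (cycle_graph l)) \<longleftrightarrow> packing (spans_cycle E l) V m"
proof
  assume "contains_copy (V, E) (disjoint_copies m (cycle_graph l))"
  then obtain f where f: "inj_on f ({..<m} \<times> {..<l})" "f ` ({..<m} \<times> {..<l}) \<subseteq> V"
    "\<forall>e\<in>{Pair i ` e | i e. i < m \<and> e \<in> {{i, Suc i mod l} | i. i < l}}. f ` e \<in> E"
    unfolding contains_copy_def cycle_graph_def disjoint_copies_def by auto
  define C where "C = (\<lambda>j. (\<lambda>i. f (j, i)) ` {..<l})"
  have edge: "{f (j, i), f (j, Suc i mod l)} \<in> E" if "j < m" "i < l" for i j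
  proof -
    have "f ` (Pair j ` {i, Suc i mod l}) \<in> E"
      using that by (intro f(3)[rule_format]) blast
    then show ?thesis by simp
  qed
  have bij: "bij_betw (\<lambda>i. f (j, i)) {..<l} (C j)" if "j < m" for j
    using f(1) that unfolding C_def bij_betw_def inj_on_def by auto
  have cyc: "spans_cycle E l (C j)" if "j < m" for j
    unfolding spans_cycle_def using bij[OF that] edge[OF that] by blast
  have disj: "C i \<inter> C j = {}" if "i < m" "j < m" "i \<noteq> j" for i j
    using f(1) that unfolding C_def inj_on_def by auto
  have ne: "C j \<noteq> {}" for j using assms unfolding C_def by auto
  have inj: "inj_on C {..<m}"
    using disj ne by (intro inj_onI) (metis inf.idem lessThan_iff)
  have sub: "C j \<subseteq> V" if "j < m" for j using f(2) that unfolding C_def by auto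
  show "packing (spans_cycle E l) V m"
    unfolding packing_def
  proof (intro exI[of _ "C ` {..<m}"] conjI ballI)
    show "card (C ` {..<m}) = m" using inj by (simp add: card_image)
    show "disjoint (C ` {..<m})" using disj by (auto simp: disjoint_def)
  qed (use cyc ne sub in auto)
next
  assume "packing (spans_cycle E l) V m"
  then obtain \<C> where \<C>: "finite \<C>" "card \<C> = m" "disjoint \<C>" "\<forall>C\<in>\<C>. spans_cycle E l C \<and> C \<noteq> {} \<and> C \<subseteq> V"
    unfolding packing_def by blast
  obtain C where C: "bij_betw C {..<m} \<C>"
    using ex_bij_betw_nat_finite[OF \<C>(1)] \<C>(2) by (auto simp: atLeast0LessThan)
  have "\<forall>j\<in>{..<m}. \<exists>g. bij_betw g {..<l} (C j) \<and> (\<forall>i<l. {g i, g (Suc i mod l)} \<in> E)"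
    using \<C>(4) bij_betw_apply[OF C] unfolding spans_cycle_def by blast
  then obtain g where g: "\<And>j. j < m \<Longrightarrow> bij_betw (g j) {..<l} (C j)"
    "\<And>j i. j < m \<Longrightarrow> i < l \<Longrightarrow> {g j i, g j (Suc i mod l)} \<in> E"
    by (metis lessThan_iff)
  have mem: "g j i \<in> C j" if "j < m" "i < l" for i j
    using bij_betw_apply[OF g(1)[OF that(1)]] that by simp
  have CV: "C j \<subseteq> V" "C j \<in> \<C>" if "j < m" for j
    using \<C>(4) bij_betw_apply[OF C] that by auto
  have "inj_on (\<lambda>(j, i). g j i) ({..<m} \<times> {..<l})"
  proof (rule inj_onI, clarsimp)
    fix j i j' i' assume *: "j < m" "i < l" "j' < m" "i' < l" "g j i = g j' i'"
    have "C j \<inter> C j' \<noteq> {}" using mem * by (metis disjoint_iff)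
    then have "C j = C j'"
      using \<C>(3) CV(2) * unfolding disjoint_def by blast
    then have "j = j'" using C * unfolding bij_betw_def inj_on_def by auto
    then show "j = j' \<and> i = i'" using g(1)[of j] * unfolding bij_betw_def inj_on_def by auto
  qed
  moreover have "(\<lambda>(j, i). g j i) ` ({..<m} \<times> {..<l}) \<subseteq> V"
    using mem CV(1) by fastforce
  ultimately show "contains_copy (V, E) (disjoint_copies m (cycle_graph l))"
    unfolding contains_copy_def cycle_graph_def disjoint_copies_def
    using g(2) by (intro exI[of _ "\<lambda>(j, i). g j i"]) auto
qed

lemma spans_cycle_list:
  assumes "xs \<noteq> []" "distinct xs" "successively (\<lambda>u v. {u, v} \<in> E) xs" "{last xs, hd xs} \<in> E"
  shows "spans_cycle E (length xs) (set xs)"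
  unfolding spans_cycle_def
proof (intro exI conjI allI impI)
  show "bij_betw ((!) xs) {..<length xs} (set xs)"
    using assms(2) by (simp add: bij_betw_nth)
next
  fix i assume i: "i < length xs"
  show "{xs ! i, xs ! (Suc i mod length xs)} \<in> E"
  proof (cases "Suc i = length xs")
    case True
    then have "i = length xs - 1" by simp
    then show ?thesis using assms(1,4) True by (simp add: last_conv_nth hd_conv_nth)
  next
    case False
    then show ?thesis using assms(3) i by (auto simp: successively_conv_nth)
  qed
qed

section \<open>Linking blocks through common neighbours\<close>

definition nbrs :: "'a set set \<Rightarrow> 'a \<Rightarrow> 'a set" where
  "nbrs E v = {u. {v, u} \<in> E}"

lemma nbrs_sym: "u \<in> nbrs E v \<longleftrightarrow> v \<in> nbrs E u"
  by (simp add: nbrs_def insert_commute)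

lemma pick_fresh:
  assumes "finite X" "card X < card Y"
  obtains y where "y \<in> Y" "y \<notin> X"
  using assms by (meson card_mono not_less subsetI)

text \<open>Consecutive blocks are joined by a fresh common neighbour from \<open>P\<close>, the end of one block and the start of
the next having enough of them. The bound \<open>c\<close> is kept apart from the length so that it survives the
induction.\<close>

lemma link_path:
  assumes "Bs \<noteq> []" "[] \<notin> set Bs" "distinct (concat Bs)"
    "\<forall>B\<in>set Bs. successively (\<lambda>u v. {u, v} \<in> E) B"
    "P \<inter> set (concat Bs) = {}" "length Bs \<le> c"
    "\<forall>u v. u \<in> last ` set Bs \<and> v \<in> hd ` set Bs \<longrightarrow> c \<le> card (nbrs E u \<inter> nbrs E v \<inter> P)"
  shows "\<exists>xs X. X \<subseteq> P \<and> finite X \<and> Suc (card X) = length Bs \<and> distinct xs \<and> set xs = set (concat Bs) \<union> X \<and>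
    successively (\<lambda>u v. {u, v} \<in> E) xs \<and> hd xs = hd (hd Bs) \<and> last xs = last (last Bs) \<and> xs \<noteq> []"
  using assms
proof (induction Bs rule: list_nonempty_induct)
  case (single B)
  then show ?case by (intro exI[of _ B] exI[of _ "{}"]) auto
next
  case (cons B Bs)
  have "P \<inter> set (concat Bs) = {}"
    using cons.prems(4) by auto
  then obtain xs X where X: "X \<subseteq> P" "finite X" "Suc (card X) = length Bs" "distinct xs"
    "set xs = set (concat Bs) \<union> X" "successively (\<lambda>u v. {u, v} \<in> E) xs"
    "hd xs = hd (hd Bs)" "last xs = last (last Bs)" "xs \<noteq> []"
    using cons.IH cons.prems by (simp del: set_concat) blast
  have "hd xs \<in> hd ` set Bs" using X(7) cons.hyps by simp
  then have "c \<le> card (nbrs E (last B) \<inter> nbrs E (hd xs) \<inter> P)"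
    using cons.prems(6) by simp
  then have "card X < card (nbrs E (last B) \<inter> nbrs E (hd xs) \<inter> P)"
    using X(3) cons.prems(5) by simp
  then obtain x where x: "x \<in> nbrs E (last B) \<inter> nbrs E (hd xs) \<inter> P" "x \<notin> X"
    using pick_fresh[OF X(2)] by metis
  have B: "B \<noteq> []" using cons.prems(1) by auto
  have ed: "{last B, x} \<in> E" "{x, hd xs} \<in> E"
    using x(1) by (auto simp: nbrs_def insert_commute)
  have suc: "successively (\<lambda>u v. {u, v} \<in> E) (B @ x # xs)"
    using cons.prems(3) X(6,9) B ed by (auto simp: successively_append_iff successively_Cons)
  have dist: "distinct (B @ x # xs)"
    using cons.prems(2,4) X(1,4,5) x by auto
  show ?case
    using X x suc dist B cons.hyps by (intro exI[of _ "B @ x # xs"] exI[of _ "insert x X"]) auto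
qed

text \<open>One more connector closes the path of \<open>link_path\<close>. Every cycle constructed below is of this kind:
either the blocks are single vertices of high degree and \<open>P\<close> consists of ordinary vertices, or the
blocks are ordinary vertices and short paths and \<open>P\<close> consists of vertices of high degree.\<close>

lemma link_cycle:
  assumes "Bs \<noteq> []" "[] \<notin> set Bs" "distinct (concat Bs)"
    "\<forall>B\<in>set Bs. successively (\<lambda>u v. {u, v} \<in> E) B"
    "P \<inter> set (concat Bs) = {}"
    "\<forall>u v. u \<in> last ` set Bs \<and> v \<in> hd ` set Bs \<longrightarrow> length Bs \<le> card (nbrs E u \<inter> nbrs E v \<inter> P)"
  shows "\<exists>X\<subseteq>P. finite X \<and> card X = length Bs \<and>
    spans_cycle E (length (concat Bs) + length Bs) (set (concat Bs) \<union> X)"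
proof -
  obtain xs X where X: "X \<subseteq> P" "finite X" "Suc (card X) = length Bs" "distinct xs"
    "set xs = set (concat Bs) \<union> X" "successively (\<lambda>u v. {u, v} \<in> E) xs"
    "hd xs = hd (hd Bs)" "last xs = last (last Bs)" "xs \<noteq> []"
    using link_path[OF assms(1-5) order.refl assms(6)] by blast
  have "length Bs \<le> card (nbrs E (last xs) \<inter> nbrs E (hd xs) \<inter> P)"
    using assms(1,6) X(7,8) by simp
  then have "card X < card (nbrs E (last xs) \<inter> nbrs E (hd xs) \<inter> P)"
    using X(3) by simp
  then obtain x where x: "x \<in> nbrs E (last xs) \<inter> nbrs E (hd xs) \<inter> P" "x \<notin> X"
    using pick_fresh[OF X(2)] by metis
  have ed: "{last xs, x} \<in> E" "{x, hd xs} \<in> E"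
    using x(1) by (auto simp: nbrs_def insert_commute)
  have d: "distinct (xs @ [x])" using X(1,4,5) x assms(5) by auto
  have "spans_cycle E (length (xs @ [x])) (set (xs @ [x]))"
  proof (rule spans_cycle_list)
    show "successively (\<lambda>u v. {u, v} \<in> E) (xs @ [x])"
      using X(6,9) ed(1) by (simp add: successively_append_iff)
    show "{last (xs @ [x]), hd (xs @ [x])} \<in> E" using X(9) ed(2) by simp
  qed (use d in simp_all)
  moreover have "set (xs @ [x]) = set (concat Bs) \<union> insert x X" using X(5) by auto
  moreover have "length (xs @ [x]) = length (concat Bs) + length Bs"
  proof -
    have "length (xs @ [x]) = card (set (concat Bs) \<union> insert x X)"
      using distinct_card[OF d] calculation(2) by simp
    also have "\<dots> = card (set (concat Bs)) + card (insert x X)"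
      using X(1,2) x assms(5) by (intro card_Un_disjoint) auto
    also have "card (set (concat Bs)) = length (concat Bs)"
      using distinct_card[OF assms(3)] .
    finally show ?thesis using X(2,3) x(2) by simp
  qed
  ultimately have "spans_cycle E (length (concat Bs) + length Bs) (set (concat Bs) \<union> insert x X)"
    by metis
  moreover have "insert x X \<subseteq> P" "finite (insert x X)" "card (insert x X) = length Bs"
    using X(1-3) x by simp_all
  ultimately show ?thesis by blast
qed

section \<open>Disjoint cycles by greedy choice\<close>

lemma link_vertices:
  assumes "0 < k" "card K = k" "P \<inter> K = {}"
    and "\<And>u v. u \<in> K \<Longrightarrow> v \<in> K \<Longrightarrow> k \<le> card (nbrs E u \<inter> nbrs E v \<inter> P)"
  shows "\<exists>X\<subseteq>P. finite X \<and> card X = k \<and> spans_cycle E (2 * k) (K \<union> X)"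
proof -
  have "finite K" using assms(1,2) by (metis card.infinite less_irrefl)
  then obtain vs where vs: "set vs = K" "distinct vs"
    using finite_distinct_list by blast
  have len: "length vs = k" using vs assms(2) distinct_card by fastforce
  define Bs where "Bs = map (\<lambda>v. [v]) vs"
  have cat: "concat Bs = vs" unfolding Bs_def by (induction vs) auto
  have ends: "last ` set Bs = K" "hd ` set Bs = K"
    unfolding Bs_def using vs(1) by (auto simp: image_image)
  have "\<exists>X\<subseteq>P. finite X \<and> card X = length Bs \<and>
    spans_cycle E (length (concat Bs) + length Bs) (set (concat Bs) \<union> X)"
  proof (rule link_cycle)
    show "Bs \<noteq> []" using len assms(1) unfolding Bs_def by auto
    show "\<forall>B\<in>set Bs. successively (\<lambda>u v. {u, v} \<in> E) B" unfolding Bs_def by auto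
    show "[] \<notin> set Bs" unfolding Bs_def by auto
    show "distinct (concat Bs)" "P \<inter> set (concat Bs) = {}"
      unfolding cat using vs assms(3) by auto
    show "\<forall>u v. u \<in> last ` set Bs \<and> v \<in> hd ` set Bs \<longrightarrow> length Bs \<le> card (nbrs E u \<inter> nbrs E v \<inter> P)"
      unfolding ends using assms(4) len by (simp add: Bs_def)
  qed
  moreover have "length Bs = k" unfolding Bs_def using len by simp
  ultimately show ?thesis unfolding cat vs(1) len by (simp add: mult_2)
qed

lemma card_common_outside:
  assumes "finite Z" "g \<le> card N" "N \<subseteq> V" "card Z + m \<le> g"
  shows "m \<le> card (N \<inter> (V - Z))"
proof -
  have "N \<inter> (V - Z) = N - Z" using assms(3) by blast
  then show ?thesis using diff_card_le_card_Diff[OF assms(1), of N] assms(2,4) by simp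
qed

text \<open>As long as \<open>c\<close> vertices of \<open>A\<close> are left, they contain \<open>k\<close> vertices with many pairwise common neighbours,
which form a cycle with \<open>k\<close> vertices outside the forbidden set \<open>Z\<close>; these join \<open>Z\<close> for the next
round. Only the last round needs \<open>c\<close> vertices, hence the term \<open>card A + k\<close>. The bound \<open>g\<close> leaves
\<open>k\<close> connectors in each round.\<close>

lemma greedy_packing:
  assumes "0 < k" and N: "\<And>u. nbrs E u \<subseteq> V"
    and sel: "\<And>T. T \<subseteq> A \<Longrightarrow> card T = c \<Longrightarrow>
      \<exists>K\<subseteq>T. card K = k \<and> (\<forall>u\<in>K. \<forall>v\<in>K. g \<le> card (nbrs E u \<inter> nbrs E v))"
    and "A \<subseteq> Z" "finite Z" "k * j + c \<le> card A + k" "card Z + k * j \<le> g"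
  shows "packing (spans_cycle E (2 * k)) (A \<union> (V - Z)) j"
  using assms(3-)
proof (induction j arbitrary: A Z)
  case (Suc j)
  have "c \<le> card A" using Suc.prems(4) by simp
  then obtain T where "T \<subseteq> A" "card T = c"
    using obtain_subset_with_card_n by metis
  from Suc.prems(1)[OF this] obtain K where K: "K \<subseteq> T" "card K = k"
    "\<forall>u\<in>K. \<forall>v\<in>K. g \<le> card (nbrs E u \<inter> nbrs E v)" by blast
  have KA: "K \<subseteq> A" using K(1) \<open>T \<subseteq> A\<close> by blast
  have finA: "finite A" using Suc.prems(2,3) finite_subset by blast
  have "\<exists>X\<subseteq>V - Z. finite X \<and> card X = k \<and> spans_cycle E (2 * k) (K \<union> X)"
  proof (rule link_vertices[OF assms(1) K(2)])
    show "(V - Z) \<inter> K = {}" using KA Suc.prems(2) by blast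
    fix u v assume uv: "u \<in> K" "v \<in> K"
    show "k \<le> card (nbrs E u \<inter> nbrs E v \<inter> (V - Z))"
    proof (rule card_common_outside[OF Suc.prems(3)])
      show "g \<le> card (nbrs E u \<inter> nbrs E v)" using K(3) uv by blast
      show "nbrs E u \<inter> nbrs E v \<subseteq> V" using N by blast
      show "card Z + k \<le> g" using Suc.prems(5) by simp
    qed
  qed
  then obtain X where X: "X \<subseteq> V - Z" "finite X" "card X = k" "spans_cycle E (2 * k) (K \<union> X)"
    by blast
  have "packing (spans_cycle E (2 * k)) ((A - K) \<union> (V - (Z \<union> X))) j"
  proof (rule Suc.IH)
    show "\<exists>K\<subseteq>T. card K = k \<and> (\<forall>u\<in>K. \<forall>v\<in>K. g \<le> card (nbrs E u \<inter> nbrs E v))"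
      if "T \<subseteq> A - K" "card T = c" for T
      using Suc.prems(1)[of T] that by auto
    show "k * j + c \<le> card (A - K) + k"
    proof -
      have "card (A - K) + k = card A"
        using card_Diff_subset[of K A] card_mono[OF finA KA] KA K(2) finA finite_subset
        by fastforce
      then show ?thesis using Suc.prems(4) by simp
    qed
    show "card (Z \<union> X) + k * j \<le> g"
      using card_Un_le[of Z X] X(3) Suc.prems(5) by simp
  qed (use Suc.prems X in auto)
  moreover have "(K \<union> X) \<inter> ((A - K) \<union> (V - (Z \<union> X))) = {}"
    using KA Suc.prems(2) X(1) by blast
  moreover have "K \<union> X \<noteq> {}" using spans_cycle_nonempty[OF X(4)] assms(1) by simp
  ultimately have "packing (spans_cycle E (2 * k)) ((K \<union> X) \<union> ((A - K) \<union> (V - (Z \<union> X)))) (1 + j)"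
    by (intro packing_add[OF packing_single[of "spans_cycle E (2 * k)" "K \<union> X"]] X(4))
  then have "packing (spans_cycle E (2 * k)) (A \<union> (V - Z)) (1 + j)"
    by (rule packing_mono) (use KA X(1) in blast)
  then show ?case by simp
qed simp

text \<open>Paths with ends in \<open>L\<close> having in total two vertices more than there are paths: a path on three vertices
or two disjoint edges. Filling up with single vertices of \<open>L\<close> gives \<open>k-1\<close> blocks on \<open>k+1\<close> vertices,
which \<open>k-1\<close> connectors turn into a \<open>2k\<close>-cycle.\<close>

definition linkable :: "'a set set \<Rightarrow> 'a set \<Rightarrow> 'a set \<Rightarrow> bool" where
  "linkable E L Y \<longleftrightarrow>
     (\<exists>Bs. Bs \<noteq> [] \<and> [] \<notin> set Bs \<and> length Bs \<le> 2 \<and> distinct (concat Bs) \<and> set (concat Bs) = Y \<and>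
        length (concat Bs) = length Bs + 2 \<and>
        (\<forall>B\<in>set Bs. successively (\<lambda>u v. {u, v} \<in> E) B \<and> hd B \<in> L \<and> last B \<in> L))"

lemma linkable_path:
  assumes "{x, y} \<in> E" "{y, z} \<in> E" "x \<in> L" "z \<in> L" "distinct [x, y, z]"
  shows "linkable E L {x, y, z}"
  unfolding linkable_def using assms by (intro exI[of _ "[[x, y, z]]"]) auto

lemma linkable_matching:
  assumes "{x, y} \<in> E" "{z, w} \<in> E" "{x, y, z, w} \<subseteq> L" "distinct [x, y, z, w]"
  shows "linkable E L {x, y, z, w}"
  unfolding linkable_def using assms by (intro exI[of _ "[[x, y], [z, w]]"]) auto

text \<open>The configurations that allow a cycle with at most \<open>k-1\<close> vertices of high degree, where \<open>L\<close> stands for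
the vertices that are adjacent to most vertices of high degree.\<close>

definition saving :: "'a set set \<Rightarrow> nat \<Rightarrow> 'a set \<Rightarrow> 'a set \<Rightarrow> bool" where
  "saving E k L Y \<longleftrightarrow> spans_cycle E (2 * k) Y \<or> linkable E L Y"

lemma saving_card:
  assumes "2 \<le> k" "saving E k L Y"
  shows "finite Y \<and> card Y \<le> 2 * k"
proof -
  have "finite Y \<and> card Y \<le> 4" if Y: "linkable E L Y"
  proof -
    obtain Bs where "length Bs \<le> 2" "length (concat Bs) = length Bs + 2" "set (concat Bs) = Y"
      using Y unfolding linkable_def by blast
    then show ?thesis using card_length[of "concat Bs"] by auto
  qed
  then show ?thesis using assms spans_cycle_card[of E "2 * k" Y] unfolding saving_def by auto
qed

lemma saving_nonempty:
  assumes "saving E k L Y" "0 < k"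
  shows "Y \<noteq> {}"
proof (cases "spans_cycle E (2 * k) Y")
  case True
  then show ?thesis using spans_cycle_nonempty[of E "2 * k" Y] assms(2) by simp
next
  case False
  then have "linkable E L Y" using assms(1) unfolding saving_def by simp
  then obtain Bs where "length (concat Bs) = length Bs + 2" "set (concat Bs) = Y"
    unfolding linkable_def by blast
  then show ?thesis by (cases "concat Bs") auto
qed

text \<open>A \<open>2k\<close>-cycle needs nothing else; a linkable set has at most two blocks, so for \<open>k \<ge> 3\<close> it can be
extended to \<open>k-1\<close> blocks by vertices of the reservoir \<open>R\<close>, and the connectors are taken from \<open>A\<close>.\<close>

lemma saving_completes:
  assumes "3 \<le> k" "saving E k L Y" "finite R" "R \<subseteq> L" "R \<inter> Y = {}" "k \<le> card R" "A \<inter> (Y \<union> R) = {}"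
    and "\<And>u v. u \<in> L \<Longrightarrow> v \<in> L \<Longrightarrow> k \<le> card (nbrs E u \<inter> nbrs E v \<inter> A)"
  shows "\<exists>B\<subseteq>A. \<exists>R'\<subseteq>R. finite B \<and> card B \<le> k - 1 \<and> card R' \<le> k \<and> spans_cycle E (2 * k) (Y \<union> B \<union> R')"
proof (cases "spans_cycle E (2 * k) Y")
  case True
  then show ?thesis by (intro exI[of _ "{}"] conjI) simp_all
next
  case False
  then have "linkable E L Y" using assms(2) unfolding saving_def by simp
  then obtain Bs where Bs: "Bs \<noteq> []" "[] \<notin> set Bs" "length Bs \<le> 2" "distinct (concat Bs)"
    "set (concat Bs) = Y" "length (concat Bs) = length Bs + 2"
    "\<forall>B\<in>set Bs. successively (\<lambda>u v. {u, v} \<in> E) B \<and> hd B \<in> L \<and> last B \<in> L"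
    unfolding linkable_def by blast
  have "k - 1 - length Bs \<le> card R" using assms(6) by simp
  then obtain R' where R': "R' \<subseteq> R" "card R' = k - 1 - length Bs" "finite R'"
    using obtain_subset_with_card_n by metis
  obtain vs where vs: "set vs = R'" "distinct vs"
    using finite_distinct_list R'(3) by blast
  have len: "length vs = k - 1 - length Bs" using vs R'(2) distinct_card by fastforce
  define Cs where "Cs = Bs @ map (\<lambda>v. [v]) vs"
  have cat': "concat (map (\<lambda>v. [v]) us) = us" for us :: "'a list" by (induction us) auto
  have cat: "concat Cs = concat Bs @ vs" unfolding Cs_def by (simp add: cat')
  have lenC: "length Cs = k - 1" unfolding Cs_def using len Bs(3) assms(1) by simp
  have ends: "last ` set Cs \<subseteq> L" "hd ` set Cs \<subseteq> L"
    unfolding Cs_def using Bs(7) vs(1) R'(1) assms(4) by auto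
  have "\<exists>X\<subseteq>A. finite X \<and> card X = length Cs \<and>
    spans_cycle E (length (concat Cs) + length Cs) (set (concat Cs) \<union> X)"
  proof (rule link_cycle)
    show "Cs \<noteq> []" using Bs(1) unfolding Cs_def by simp
    show "\<forall>B\<in>set Cs. successively (\<lambda>u v. {u, v} \<in> E) B" using Bs(7) unfolding Cs_def by auto
    show "[] \<notin> set Cs" unfolding Cs_def using Bs(2) by auto
    have "set (concat Bs) \<inter> set vs = {}" using Bs(5) vs(1) R'(1) assms(5) by blast
    then show "distinct (concat Cs)" using Bs(4) vs(2) unfolding cat distinct_append by blast
    have "set (concat Cs) = Y \<union> R'" unfolding cat set_append Bs(5) vs(1) ..
    then show "A \<inter> set (concat Cs) = {}" using assms(7) R'(1) by blast
    show "\<forall>u v. u \<in> last ` set Cs \<and> v \<in> hd ` set Cs \<longrightarrow> length Cs \<le> card (nbrs E u \<inter> nbrs E v \<inter> A)"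
    proof (intro allI impI)
      fix u v assume "u \<in> last ` set Cs \<and> v \<in> hd ` set Cs"
      then have "k \<le> card (nbrs E u \<inter> nbrs E v \<inter> A)"
        by (intro assms(8)) (use ends in auto)
      then show "length Cs \<le> card (nbrs E u \<inter> nbrs E v \<inter> A)" unfolding lenC by simp
    qed
  qed
  then obtain X where X: "X \<subseteq> A" "finite X" "card X = length Cs"
    "spans_cycle E (length (concat Cs) + length Cs) (set (concat Cs) \<union> X)" by blast
  have "length (concat Cs) + length Cs = 2 * k"
    unfolding lenC cat length_append Bs(6) len using Bs(3) assms(1) by linarith
  moreover have "set (concat Cs) \<union> X = Y \<union> X \<union> R'"
    unfolding cat set_append Bs(5) vs(1) by blast
  ultimately have "spans_cycle E (2 * k) (Y \<union> X \<union> R')" using X(4) by metis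
  then show ?thesis using X(1-3) lenC R'(1,2)
    by (intro exI[of _ X] exI[of _ R'] conjI) simp_all
qed

text \<open>The savings are completed one after the other. Each of them takes fewer than \<open>k\<close> vertices of \<open>A\<close> and
at most \<open>k\<close> of \<open>R\<close>, so the bounds \<open>k * j\<close> on the reservoir and on the common neighbourhoods decrease with
the number of savings that are left.\<close>

lemma savings_to_cycles:
  assumes "3 \<le> k" "packing (saving E k L) W j" "finite R" "R \<subseteq> L" "R \<inter> W = {}" "k * j \<le> card R"
    "A \<inter> (W \<union> R) = {}" "finite A"
    and "\<And>u v. u \<in> L \<Longrightarrow> v \<in> L \<Longrightarrow> k * j \<le> card (nbrs E u \<inter> nbrs E v \<inter> A)"
  shows "\<exists>B\<subseteq>A. card B \<le> (k - 1) * j \<and> packing (spans_cycle E (2 * k)) (W \<union> B \<union> R) j"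
  using assms(2-)
proof (induction j arbitrary: W R A)
  case 0
  show ?case by (intro exI[of _ "{}"]) simp
next
  case (Suc j)
  from Suc.prems(1) obtain Y W' where Y: "saving E k L Y" "Y \<noteq> {}" "Y \<subseteq> W" "W' \<subseteq> W" "Y \<inter> W' = {}"
    "packing (saving E k L) W' j"
    by (rule packing_SucE)
  have "\<exists>B\<subseteq>A. \<exists>R'\<subseteq>R. finite B \<and> card B \<le> k - 1 \<and> card R' \<le> k \<and> spans_cycle E (2 * k) (Y \<union> B \<union> R')"
  proof (rule saving_completes[OF assms(1) Y(1) Suc.prems(2,3)])
    show "R \<inter> Y = {}" "A \<inter> (Y \<union> R) = {}" using Suc.prems(4,6) Y(3) by blast+
    show "k \<le> card R" using Suc.prems(5) by simp
    show "k \<le> card (nbrs E u \<inter> nbrs E v \<inter> A)" if "u \<in> L" "v \<in> L" for u v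
      using Suc.prems(8)[OF that] by simp
  qed
  then obtain B R' where B: "B \<subseteq> A" "R' \<subseteq> R" "finite B" "card B \<le> k - 1" "card R' \<le> k"
    "spans_cycle E (2 * k) (Y \<union> B \<union> R')" by blast
  have "\<exists>B'\<subseteq>A - B. card B' \<le> (k - 1) * j \<and> packing (spans_cycle E (2 * k)) (W' \<union> B' \<union> (R - R')) j"
  proof (rule Suc.IH[OF Y(6)])
    show "finite (R - R')" "finite (A - B)" "R - R' \<subseteq> L" using Suc.prems by auto
    show "(R - R') \<inter> W' = {}" "(A - B) \<inter> (W' \<union> (R - R')) = {}"
      using Suc.prems(4,6) Y(4) by blast+
    have "card R - card R' \<le> card (R - R')"
      using diff_card_le_card_Diff[of R' R] B(2) Suc.prems(2) finite_subset by blast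
    then show "k * j \<le> card (R - R')" using Suc.prems(5) B(5) by simp
    fix u v assume uv: "u \<in> L" "v \<in> L"
    have "card (nbrs E u \<inter> nbrs E v \<inter> A) - card B \<le> card (nbrs E u \<inter> nbrs E v \<inter> A - B)"
      using diff_card_le_card_Diff[OF B(3)] .
    moreover have "nbrs E u \<inter> nbrs E v \<inter> A - B = nbrs E u \<inter> nbrs E v \<inter> (A - B)" by blast
    ultimately show "k * j \<le> card (nbrs E u \<inter> nbrs E v \<inter> (A - B))"
      using Suc.prems(8)[OF uv] B(4) by simp
  qed
  then obtain B' where B': "B' \<subseteq> A - B" "card B' \<le> (k - 1) * j"
    "packing (spans_cycle E (2 * k)) (W' \<union> B' \<union> (R - R')) j" by blast
  have "(Y \<union> B \<union> R') \<inter> (W' \<union> B' \<union> (R - R')) = {}"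
    using Y(3,4,5) B(1,2) B'(1) Suc.prems(4,6) by blast
  moreover have "Y \<union> B \<union> R' \<noteq> {}" using Y(2) by blast
  ultimately have "packing (spans_cycle E (2 * k)) ((Y \<union> B \<union> R') \<union> (W' \<union> B' \<union> (R - R'))) (1 + j)"
    using packing_add[OF packing_single[of "spans_cycle E (2 * k)", OF B(6)] B'(3)] by simp
  then have "packing (spans_cycle E (2 * k)) (W \<union> (B \<union> B') \<union> R) (Suc j)"
    unfolding plus_1_eq_Suc by (rule packing_mono) (use Y(3,4) B(2) in blast)
  moreover have "card (B \<union> B') \<le> (k - 1) * Suc j"
    using card_Un_le[of B B'] B(4) B'(2) by simp
  moreover have "B \<union> B' \<subseteq> A" using B(1) B'(1) by blast
  ultimately show ?case by blast
qed

section \<open>Counting edges\<close>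

lemma choose_2_add: "(N + s) choose 2 = (N choose 2) + s * N + (s choose 2)"
  by (induction s) (simp_all add: numeral_2_eq_2)

locale fin_graph =
  fixes V :: "'a set" and E :: "'a set set"
  assumes finite_V: "finite V" and E_sub: "E \<subseteq> [V]\<^bsup>2\<^esup>"
begin

lemma finite_E: "finite E"
  using finite_subset[OF E_sub finite_imp_finite_nsets[OF finite_V]] .

lemma edgeE:
  assumes "e \<in> E"
  obtains u v where "e = {u, v}" "u \<noteq> v" "u \<in> V" "v \<in> V"
proof -
  have "e \<in> [V]\<^bsup>2\<^esup>" using assms E_sub by blast
  then show thesis using that by (auto simp: nsets_2_eq)
qed

lemma nbrs_sub: "nbrs E v \<subseteq> V - {v}"
proof
  fix u assume "u \<in> nbrs E v"
  then have "{v, u} \<in> [V]\<^bsup>2\<^esup>" using E_sub unfolding nbrs_def by blast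
  then show "u \<in> V - {v}" by auto
qed

lemma finite_nbrs: "finite (nbrs E v)"
  using nbrs_sub finite_V finite_subset by blast

lemma card_nbrs_le: "card (nbrs E v) \<le> card V"
  using nbrs_sub finite_V by (meson card_mono Diff_subset order_trans)

text \<open>Deleting \<open>X\<close> loses at most the degrees in \<open>X\<close>.\<close>

lemma edges_split:
  assumes "finite X"
  shows "card (E \<inter> Pow S) \<le> card (E \<inter> Pow (S - X)) + (\<Sum>x\<in>X. card (nbrs E x \<inter> S))"
proof -
  have "E \<inter> Pow S \<subseteq> (E \<inter> Pow (S - X)) \<union> (\<Union>x\<in>X. (\<lambda>u. {x, u}) ` (nbrs E x \<inter> S))"
  proof
    fix e assume e: "e \<in> E \<inter> Pow S"
    then obtain u v where uv: "e = {u, v}" by (auto elim: edgeE)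
    show "e \<in> (E \<inter> Pow (S - X)) \<union> (\<Union>x\<in>X. (\<lambda>u. {x, u}) ` (nbrs E x \<inter> S))"
    proof (cases "e \<subseteq> S - X")
      case False
      then consider "u \<in> X" | "v \<in> X" using uv e by auto
      then show ?thesis
      proof cases
        case 1
        then have "v \<in> nbrs E u \<inter> S" using e uv unfolding nbrs_def by auto
        then show ?thesis using uv 1 by blast
      next
        case 2
        then have "u \<in> nbrs E v \<inter> S" using e uv unfolding nbrs_def by (auto simp: insert_commute)
        moreover have "e = {v, u}" using uv by auto
        ultimately show ?thesis using 2 by blast
      qed
    qed (use e in auto)
  qed
  then have "card (E \<inter> Pow S) \<le> card ((E \<inter> Pow (S - X)) \<union> (\<Union>x\<in>X. (\<lambda>u. {x, u}) ` (nbrs E x \<inter> S)))"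
    using finite_E assms finite_nbrs by (intro card_mono) auto
  also have "\<dots> \<le> card (E \<inter> Pow (S - X)) + card (\<Union>x\<in>X. (\<lambda>u. {x, u}) ` (nbrs E x \<inter> S))"
    by (rule card_Un_le)
  also have "card (\<Union>x\<in>X. (\<lambda>u. {x, u}) ` (nbrs E x \<inter> S)) \<le> (\<Sum>x\<in>X. card ((\<lambda>u. {x, u}) ` (nbrs E x \<inter> S)))"
    using card_UN_le[OF assms] .
  also have "\<dots> \<le> (\<Sum>x\<in>X. card (nbrs E x \<inter> S))"
    using finite_nbrs by (intro sum_mono card_image_le) auto
  finally show ?thesis by simp
qed

text \<open>Edges of \<open>S\<close> outside \<open>U\<close> and the known non-edges \<open>M\<close> are distinct pairs of \<open>S\<close> that are not inside \<open>U\<close>.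
The binomials are kept on both sides to avoid subtraction.\<close>

lemma edges_plus_missing:
  assumes "S \<subseteq> V" "U \<subseteq> S" "M \<subseteq> [S]\<^bsup>2\<^esup> - [U]\<^bsup>2\<^esup>" "M \<inter> E = {}"
  shows "card (E \<inter> Pow S) + card M + (card U choose 2) \<le> (card S choose 2) + card (E \<inter> Pow U)"
proof -
  have fin: "finite S" "finite U"
    using assms(1,2) finite_V by (meson finite_subset)+
  have finS: "finite ([S]\<^bsup>2\<^esup>)" using finite_imp_finite_nsets[OF fin(1)] .
  have finM: "finite M" using assms(3) finS by (meson Diff_subset finite_subset)
  have "E \<inter> Pow S \<subseteq> ([S]\<^bsup>2\<^esup> - [U]\<^bsup>2\<^esup> - M) \<union> (E \<inter> Pow U)"
  proof
    fix e assume e: "e \<in> E \<inter> Pow S"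
    then have "e \<in> [V]\<^bsup>2\<^esup>" "e \<notin> M" using E_sub assms(4) by blast+
    moreover have "e \<in> [S]\<^bsup>2\<^esup>" using e calculation(1) by (simp add: nsets_def)
    moreover have "e \<in> [U]\<^bsup>2\<^esup> \<Longrightarrow> e \<in> Pow U" by (simp add: nsets_def)
    ultimately show "e \<in> ([S]\<^bsup>2\<^esup> - [U]\<^bsup>2\<^esup> - M) \<union> (E \<inter> Pow U)" using e by blast
  qed
  then have "card (E \<inter> Pow S) \<le> card (([S]\<^bsup>2\<^esup> - [U]\<^bsup>2\<^esup> - M) \<union> (E \<inter> Pow U))"
    using finite_E finS by (intro card_mono) auto
  also have "\<dots> \<le> card ([S]\<^bsup>2\<^esup> - [U]\<^bsup>2\<^esup> - M) + card (E \<inter> Pow U)"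
    by (rule card_Un_le)
  also have "card ([S]\<^bsup>2\<^esup> - [U]\<^bsup>2\<^esup> - M) = card ([S]\<^bsup>2\<^esup> - [U]\<^bsup>2\<^esup>) - card M"
    using assms(3) finM by (intro card_Diff_subset) simp_all
  also have "card ([S]\<^bsup>2\<^esup> - [U]\<^bsup>2\<^esup>) = (card S choose 2) - (card U choose 2)"
    using nsets_mono[OF assms(2), of 2] finite_imp_finite_nsets[OF fin(2), of 2]
    by (simp add: card_Diff_subset)
  finally have "card (E \<inter> Pow S) \<le> (card S choose 2) - (card U choose 2) - card M + card (E \<inter> Pow U)" .
  moreover have "card M \<le> (card S choose 2) - (card U choose 2)"
    using card_mono[OF _ assms(3)] finS
      \<open>card ([S]\<^bsup>2\<^esup> - [U]\<^bsup>2\<^esup>) = (card S choose 2) - (card U choose 2)\<close> by simp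
  moreover have "(card U choose 2) \<le> (card S choose 2)"
    using card_mono[OF finS(1) nsets_mono[OF assms(2)]] by simp
  ultimately show ?thesis by linarith
qed

section \<open>Configurations forced by degrees and by density\<close>

text \<open>The Kovari--Sos--Turan argument. By double counting, at least \<open>d/2\<close> vertices have at least \<open>k\<close> neighbours in
\<open>T\<close>; each of them selects a \<open>k\<close>-subset of its neighbours in \<open>T\<close>, and since \<open>T\<close> has only \<open>2 ^ c\<close>
subsets, one of them is selected more than \<open>g\<close> times.\<close>

lemma popular_subset:
  fixes d :: real
  assumes "T \<subseteq> V" "card T = c" "0 < c" "\<forall>v\<in>T. d \<le> card (nbrs E v)"
    and "2 * real k * card V \<le> d * c" "real g * 2 ^ (c + 1) < d"
  shows "\<exists>K\<subseteq>T. card K = k \<and> (\<forall>u\<in>K. \<forall>v\<in>K. g \<le> card (nbrs E u \<inter> nbrs E v))"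
proof -
  have finT: "finite T" using assms(1) finite_V finite_subset by blast
  define V' where "V' = {u \<in> V. k \<le> card (nbrs E u \<inter> T)}"
  have V': "V' \<subseteq> V" "finite V'" unfolding V'_def using finite_V by auto
  have deg: "card (nbrs E v) = (\<Sum>u\<in>V. if u \<in> nbrs E v then 1 else 0)" for v
    using nbrs_sub[of v] finite_V by (simp add: sum.If_cases) (metis Collect_mem_eq Diff_subset inf.absorb_iff2 order_trans)
  have deg': "card (nbrs E u \<inter> T) = (\<Sum>v\<in>T. if u \<in> nbrs E v then 1 else 0)" for u
    using finT by (simp add: sum.If_cases nbrs_sym[of u] Int_commute Int_def)
  have "d * c \<le> (\<Sum>v\<in>T. real (card (nbrs E v)))"
    using sum_mono[of T "\<lambda>_. d" "\<lambda>v. real (card (nbrs E v))"] assms(2,4) by (simp add: mult.commute)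
  also have "\<dots> = real (\<Sum>v\<in>T. \<Sum>u\<in>V. if u \<in> nbrs E v then 1 else 0)"
    by (simp add: deg)
  also have "(\<Sum>v\<in>T. \<Sum>u\<in>V. if u \<in> nbrs E v then 1 else 0) = (\<Sum>u\<in>V. card (nbrs E u \<inter> T))"
    unfolding deg' by (rule sum.swap)
  also have "(\<Sum>u\<in>V. card (nbrs E u \<inter> T)) \<le> (\<Sum>u\<in>V. (if u \<in> V' then c else 0) + k)"
  proof (rule sum_mono)
    fix u assume "u \<in> V"
    have "card (nbrs E u \<inter> T) \<le> c" using card_mono[OF finT, of "nbrs E u \<inter> T"] assms(2) by simp
    then show "card (nbrs E u \<inter> T) \<le> (if u \<in> V' then c else 0) + k"
      using \<open>u \<in> V\<close> unfolding V'_def by auto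
  qed
  also have "\<dots> = card V' * c + card V * k"
    using V' finite_V by (simp add: sum.distrib sum.If_cases Int_absorb1 Int_commute)
  finally have "d * c \<le> real (card V') * c + card V * k" by simp
  then have "d * c \<le> 2 * real (card V') * c" using assms(5) by (simp add: algebra_simps)
  then have large: "d \<le> 2 * card V'" using assms(3) by simp
  have "\<forall>u\<in>V'. \<exists>K\<subseteq>nbrs E u \<inter> T. card K = k"
    unfolding V'_def using obtain_subset_with_card_n by blast
  then obtain f where f: "\<And>u. u \<in> V' \<Longrightarrow> f u \<subseteq> nbrs E u \<inter> T" "\<And>u. u \<in> V' \<Longrightarrow> card (f u) = k"
    by metis
  have fin: "finite (f ` V')" "card (f ` V') \<le> 2 ^ c"
  proof -
    have "f ` V' \<subseteq> Pow T" using f(1) by blast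
    then show "card (f ` V') \<le> 2 ^ c"
      using card_mono[of "Pow T" "f ` V'"] finT assms(2) by (simp add: card_Pow)
  qed (use V' in simp)
  have "\<exists>K\<in>f ` V'. g < card {u \<in> V'. f u = K}"
  proof (rule ccontr)
    assume "\<not> ?thesis"
    then have small: "\<forall>K\<in>f ` V'. card {u \<in> V'. f u = K} \<le> g" by auto
    have "V' = (\<Union>K\<in>f ` V'. {u \<in> V'. f u = K})" by blast
    then have "card V' \<le> (\<Sum>K\<in>f ` V'. card {u \<in> V'. f u = K})"
      using card_UN_le[OF fin(1), of "\<lambda>K. {u \<in> V'. f u = K}"] by simp
    also have "\<dots> \<le> (\<Sum>K\<in>f ` V'. g)" using small by (intro sum_mono) blast
    also have "\<dots> \<le> 2 ^ c * g" using fin(2) by simp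
    finally have "real (card V') \<le> real (2 ^ c * g)"
      by (rule of_nat_mono)
    then have "real (card V') \<le> 2 ^ c * real g" by simp
    moreover have "real g * 2 ^ (c + 1) = 2 * (2 ^ c * real g)" by simp
    moreover have "d \<le> 2 * real (card V')" using large by simp
    ultimately show False using assms(6) by linarith
  qed
  then obtain K where K: "K \<in> f ` V'" "g < card {u \<in> V'. f u = K}" by blast
  have "g \<le> card (nbrs E u \<inter> nbrs E v)" if "u \<in> K" "v \<in> K" for u v
  proof -
    have "{w \<in> V'. f w = K} \<subseteq> nbrs E u \<inter> nbrs E v"
      using f(1) that nbrs_sym by fast
    then have "card {w \<in> V'. f w = K} \<le> card (nbrs E u \<inter> nbrs E v)"
      using finite_nbrs by (intro card_mono) auto
    then show ?thesis using K(2) by simp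
  qed
  then show ?thesis using K(1) f by (intro exI[of _ K]) blast
qed

text \<open>A vertex with many neighbours in \<open>L\<close> is the centre of a path on three vertices with ends in \<open>L\<close>;
the centre itself may lie outside \<open>L\<close>.\<close>

lemma stars_packing:
  assumes "finite Q" "finite Z" "Q \<subseteq> Z"
    and "\<And>v. v \<in> Q \<Longrightarrow> card Z + 2 * card Q \<le> card (nbrs E v \<inter> L \<inter> U)"
  shows "packing (linkable E L) (Q \<union> (U - Z)) (card Q)"
  using assms
proof (induction Q arbitrary: Z rule: finite_induct)
  case (insert v Q)
  have cardQ: "card (insert v Q) = Suc (card Q)" using insert.hyps by simp
  have "card Z + 2 \<le> card (nbrs E v \<inter> L \<inter> U)"
    using insert.prems(3)[of v] cardQ by simp
  then have "2 \<le> card (nbrs E v \<inter> L \<inter> U - Z)"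
    using diff_card_le_card_Diff[OF insert.prems(1), of "nbrs E v \<inter> L \<inter> U"] by simp
  then obtain X where X: "X \<subseteq> nbrs E v \<inter> L \<inter> U - Z" "card X = 2"
    using obtain_subset_with_card_n by metis
  then obtain x z where xz: "X = {x, z}" "x \<noteq> z" by (auto simp: card_2_iff)
  have star: "linkable E L {x, v, z}"
  proof (rule linkable_path)
    show "{x, v} \<in> E" "{v, z} \<in> E" "x \<in> L" "z \<in> L"
      using X(1) xz unfolding nbrs_def by (auto simp: insert_commute)
    show "distinct [x, v, z]" using X(1) xz nbrs_sub[of v] by auto
  qed
  have "packing (linkable E L) (Q \<union> (U - (Z \<union> X))) (card Q)"
  proof (rule insert.IH)
    show "finite (Z \<union> X)" using insert.prems(1) xz by simp
    show "Q \<subseteq> Z \<union> X" using insert.prems(2) by blast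
    show "card (Z \<union> X) + 2 * card Q \<le> card (nbrs E w \<inter> L \<inter> U)" if "w \<in> Q" for w
      using insert.prems(3)[of w] that card_Un_le[of Z X] X(2) cardQ by simp
  qed
  moreover have "{x, v, z} \<inter> (Q \<union> (U - (Z \<union> X))) = {}"
    using X(1) xz insert.hyps insert.prems(2) by auto
  ultimately have "packing (linkable E L) ({x, v, z} \<union> (Q \<union> (U - (Z \<union> X)))) (1 + card Q)"
    by (intro packing_add[OF packing_single[of "linkable E L", OF star]]) auto
  then have "packing (linkable E L) (insert v Q \<union> (U - Z)) (1 + card Q)"
    by (rule packing_mono) (use X(1) xz in auto)
  then show ?case using cardQ by simp
qed simp

text \<open>Inside \<open>L\<close> two edges would form a path or a matching, so there is at most one. A vertex outside \<open>L\<close> has at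
most one neighbour in \<open>L\<close>, as two would be the ends of a path. The edges inside the complement of \<open>L\<close>
contain no cycle of length \<open>2k\<close>, so the sparsity of cycle-free sets bounds them.\<close>

lemma edges_without_saving:
  fixes \<sigma> :: real
  assumes "Y \<subseteq> V" and none: "\<And>C. saving E k L C \<Longrightarrow> C \<subseteq> Y \<Longrightarrow> False"
    and sparse: "\<And>S. S \<subseteq> V \<Longrightarrow> (\<And>C. C \<subseteq> S \<Longrightarrow> \<not> spans_cycle E (2 * k) C) \<Longrightarrow>
        real (card (E \<inter> Pow S)) \<le> \<sigma> * card S"
  shows "real (card (E \<inter> Pow Y)) \<le> 1 + (1 + \<sigma>) * card (Y - L)"
proof -
  have finF: "finite (Y - L)" using assms(1) finite_V finite_subset by blast
  have no_path: False if "{x, y} \<in> E" "{y, z} \<in> E" "x \<in> L" "z \<in> L" "x \<noteq> z" "{x, y, z} \<subseteq> Y" for x y z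
  proof -
    have "x \<noteq> y" "y \<noteq> z"
      using nbrs_sub[of x] nbrs_sub[of y] that(1,2) unfolding nbrs_def by auto
    then have "linkable E L {x, y, z}" by (intro linkable_path) (use that in auto)
    then show False using none that(6) unfolding saving_def by blast
  qed
  have no_match: False if "{x, y} \<in> E" "{z, w} \<in> E" "{x, y, z, w} \<subseteq> L \<inter> Y" "distinct [x, y, z, w]" for x y z w
  proof -
    have "linkable E L {x, y, z, w}" by (rule linkable_matching) (use that in auto)
    then show False using none that(3) unfolding saving_def by blast
  qed
  have eq: "e = e'" if e: "e \<in> E \<inter> Pow (Y \<inter> L)" "e' \<in> E \<inter> Pow (Y \<inter> L)" for e e'
  proof (rule ccontr)
    assume ne: "e \<noteq> e'"
    obtain x y where xy: "e = {x, y}" "x \<noteq> y" using e(1) by (auto elim: edgeE)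
    obtain z w where zw: "e' = {z, w}" "z \<noteq> w" using e(2) by (auto elim: edgeE)
    have mem: "{x, y} \<in> E" "{y, x} \<in> E" "{z, w} \<in> E" "{w, z} \<in> E" "{x, y, z, w} \<subseteq> L \<inter> Y"
      using e xy zw by (auto simp: insert_commute)
    show False
    proof (cases "e \<inter> e' = {}")
      case True
      then show False using no_match[OF mem(1,3,5)] xy zw by auto
    next
      case False
      then consider "x = z" | "x = w" | "y = z" | "y = w" using xy zw by blast
      then show False
        by cases (use no_path[of y x w] no_path[of y x z] no_path[of x y w] no_path[of x y z]
            mem ne xy zw in \<open>auto simp: insert_commute\<close>)
    qed
  qed
  have "card (E \<inter> Pow (Y \<inter> L)) \<le> 1"
    using card_le_Suc0_iff_eq[of "E \<inter> Pow (Y \<inter> L)"] finite_E eq by auto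
  moreover have "card (\<Union>x\<in>Y - L. (\<lambda>u. {x, u}) ` (nbrs E x \<inter> (Y \<inter> L))) \<le> card (Y - L)"
  proof -
    have "card ((\<lambda>u. {x, u}) ` (nbrs E x \<inter> (Y \<inter> L))) \<le> 1" if "x \<in> Y - L" for x
    proof -
      have "u = v" if uv: "u \<in> nbrs E x \<inter> (Y \<inter> L)" "v \<in> nbrs E x \<inter> (Y \<inter> L)" for u v
        using no_path[of u x v] uv \<open>x \<in> Y - L\<close> unfolding nbrs_def by (auto simp: insert_commute)
      then have "card (nbrs E x \<inter> (Y \<inter> L)) \<le> 1"
        using card_le_Suc0_iff_eq[of "nbrs E x \<inter> (Y \<inter> L)"] finite_nbrs by auto
      then show ?thesis
        using card_image_le[of "nbrs E x \<inter> (Y \<inter> L)" "\<lambda>u. {x, u}"] finite_nbrs by auto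
    qed
    then have "(\<Sum>x\<in>Y - L. card ((\<lambda>u. {x, u}) ` (nbrs E x \<inter> (Y \<inter> L)))) \<le> (\<Sum>x\<in>Y - L. 1)"
      by (rule sum_mono)
    then show ?thesis
      using card_UN_le[OF finF, of "\<lambda>x. (\<lambda>u. {x, u}) ` (nbrs E x \<inter> (Y \<inter> L))"] by simp
  qed
  moreover have "card (E \<inter> Pow Y) \<le> card (E \<inter> Pow (Y \<inter> L)) + card (E \<inter> Pow (Y - L)) +
      card (\<Union>x\<in>Y - L. (\<lambda>u. {x, u}) ` (nbrs E x \<inter> (Y \<inter> L)))"
  proof -
    have "E \<inter> Pow Y \<subseteq> (E \<inter> Pow (Y \<inter> L)) \<union> (E \<inter> Pow (Y - L)) \<union>
      (\<Union>x\<in>Y - L. (\<lambda>u. {x, u}) ` (nbrs E x \<inter> (Y \<inter> L)))" (is "_ \<subseteq> ?R")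
    proof
      fix e assume e: "e \<in> E \<inter> Pow Y"
      then obtain u v where uv: "e = {u, v}" by (auto elim: edgeE)
      have n: "v \<in> nbrs E u" "u \<in> nbrs E v" "u \<in> Y" "v \<in> Y"
        using e uv unfolding nbrs_def by (auto simp: insert_commute)
      consider "u \<in> L" "v \<in> L" | "u \<notin> L" "v \<notin> L" | "u \<notin> L" "v \<in> L" | "u \<in> L" "v \<notin> L" by blast
      then show "e \<in> ?R"
      proof cases
        case 4
        have "e = {v, u}" using uv by auto
        then show ?thesis using 4 n by blast
      qed (use e uv n in auto)
    qed
    then have "card (E \<inter> Pow Y) \<le> card ?R"
      using finite_E finF finite_nbrs by (intro card_mono) auto
    then show ?thesis
      using card_Un_le[of "(E \<inter> Pow (Y \<inter> L)) \<union> (E \<inter> Pow (Y - L))"]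
        card_Un_le[of "E \<inter> Pow (Y \<inter> L)" "E \<inter> Pow (Y - L)"]
      by (meson add_mono le_trans order_refl)
  qed
  moreover have "real (card (E \<inter> Pow (Y - L))) \<le> \<sigma> * card (Y - L)"
  proof (rule sparse)
    show "\<not> spans_cycle E (2 * k) C" if "C \<subseteq> Y - L" for C
      using none[of C] that unfolding saving_def by blast
  qed (use assms(1) in blast)
  ultimately show ?thesis by (simp add: algebra_simps)
qed

section \<open>Stability: the vertices of high degree\<close>

text \<open>Let \<open>A\<close> be the set of vertices of degree at least \<open>\<delta>n\<close> and \<open>D\<close> the sum of their degrees. Greedy packing
gives \<open>card A < k(t+1) + c\<close>. On the other hand \<open>G\<close> has at least \<open>sN\<close> edges, almost \<open>ktn\<close>, and few of them
avoid \<open>A\<close>, so \<open>D\<close> is almost \<open>ktn\<close> as well. The degrees in \<open>A\<close> therefore fall short of \<open>n\<close> by at most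
\<open>tn/64\<close> in total, and this bounds the number of those that fall short by more than \<open>n/4\<close>.
The error terms \<open>2k\<^sup>2\<epsilon> + 2\<epsilon> \<le> 1/256\<close> and \<open>2k\<delta> = 1/384\<close> add up to less than \<open>1/128\<close>.\<close>

lemma high_degree_vertices:
  fixes \<epsilon> \<sigma> \<delta> :: real
  assumes k: "3 \<le> k" and n: "card V = n" and nopack: "\<not> packing (spans_cycle E (2 * k)) V (t + 1)"
    and Ns: "n = N + s" "s + 1 = k * (t + 1)" and many: "(n choose 2) \<le> card E + (N choose 2)"
    and sparse: "\<And>S. S \<subseteq> V \<Longrightarrow> (\<And>C. C \<subseteq> S \<Longrightarrow> \<not> spans_cycle E (2 * k) C) \<Longrightarrow>
        real (card (E \<inter> Pow S)) \<le> \<sigma> * card S"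
    and \<sigma>0: "0 \<le> \<sigma>" and \<sigma>: "\<sigma> \<le> 2 * \<epsilon> * t" and t: "t \<le> \<epsilon> * n" and \<epsilon>: "(2 * (real k)\<^sup>2 + 2) * \<epsilon> \<le> 1 / 256"
    and \<delta>: "\<delta> = 1 / (768 * k)" and c: "2 * k \<le> \<delta> * c" and tc: "128 * (k + c) \<le> t"
    and big: "real (2 * k * (t + 1) + c) * 2 ^ (c + 1) < \<delta> * n"
  defines "A' \<equiv> {v \<in> V. 3 * n \<le> 4 * card (nbrs E v)}"
  shows "real s + 1 \<le> card A' + t / 4"
    and "(\<Sum>a\<in>A'. real n - card (nbrs E a)) \<le> real t * real n / 64"
proof -
  have k0: "0 < real k" and t0: "0 < real t" using k tc by auto
  have n0: "0 < real n"
  proof (rule ccontr)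
    assume "\<not> 0 < real n"
    then have "n = 0" by simp
    then show False using t t0 by simp
  qed
  have \<delta>0: "0 < \<delta>" "\<delta> \<le> 3 / 4" unfolding \<delta> using k by (simp_all add: divide_simps)
  have c0: "0 < c"
  proof (rule ccontr)
    assume "\<not> 0 < c"
    then show False using c k by simp
  qed
  have n_eq: "real (card V) = real n" using n by simp
  define A where "A = {v \<in> V. \<delta> * n \<le> card (nbrs E v)}"
  have A: "A \<subseteq> V" "finite A" unfolding A_def using finite_V by auto
  have A'A: "A' \<subseteq> A"
  proof
    fix v assume v: "v \<in> A'"
    have "\<delta> * n \<le> 3 / 4 * n" using \<delta>0(2) by (intro mult_right_mono) auto
    also have "\<dots> \<le> card (nbrs E v)" using v unfolding A'_def by auto
    finally show "v \<in> A" using v unfolding A_def A'_def by simp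
  qed
  have cardA: "card A < k * (t + 1) + c"
  proof (rule ccontr)
    assume "\<not> ?thesis"
    then have "k * (t + 1) + c \<le> card A" by simp
    then obtain B where B: "B \<subseteq> A" "card B = k * (t + 1) + c" "finite B"
      using obtain_subset_with_card_n by metis
    have "packing (spans_cycle E (2 * k)) (B \<union> (V - B)) (t + 1)"
    proof (rule greedy_packing[where c = c and g = "2 * k * (t + 1) + c"])
      fix T assume T: "T \<subseteq> B" "card T = c"
      show "\<exists>K\<subseteq>T. card K = k \<and> (\<forall>u\<in>K. \<forall>v\<in>K. 2 * k * (t + 1) + c \<le> card (nbrs E u \<inter> nbrs E v))"
      proof (rule popular_subset[OF _ T(2) c0, where d = "\<delta> * n"])
        show "T \<subseteq> V" using T(1) B(1) A(1) by blast
        show "\<forall>v\<in>T. \<delta> * n \<le> card (nbrs E v)" using T(1) B(1) unfolding A_def by blast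
        have "2 * real k * n \<le> (\<delta> * c) * n" using c by (intro mult_right_mono) auto
        then show "2 * real k * card V \<le> \<delta> * n * c" unfolding n_eq by (simp add: mult_ac)
        show "real (2 * k * (t + 1) + c) * 2 ^ (c + 1) < \<delta> * n" using big .
      qed
    qed (use k B nbrs_sub in auto)
    then have "packing (spans_cycle E (2 * k)) V (t + 1)"
      by (rule packing_mono) (use B A in blast)
    then show False using nopack by blast
  qed
  define D where "D = (\<Sum>v\<in>A. real (card (nbrs E v)))"
  \<comment> \<open>A maximal packing of cycles outside \<open>A\<close> has at most \<open>t\<close> members and low degrees; the rest is sparse.\<close>
  have outside: "real (card (E \<inter> Pow (V - A))) \<le> \<sigma> * n + 2 * k * t * (\<delta> * n)"
  proof -
    have fin: "finite (V - A)" using finite_V by simp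
    obtain m W where W: "W \<subseteq> V - A" "card W \<le> 2 * k * m" "packing (spans_cycle E (2 * k)) W m"
      "\<not> (\<exists>C. spans_cycle E (2 * k) C \<and> C \<noteq> {} \<and> C \<subseteq> V - A - W)"
      using packing_maximal[OF fin, of "spans_cycle E (2 * k)" "2 * k"] spans_cycle_card[of E "2 * k"]
      by auto
    have "W \<subseteq> V" using W(1) by blast
    then have "\<not> t + 1 \<le> m"
      using nopack packing_fewer[OF packing_mono[OF W(3)], of V "t + 1"] by metis
    then have "card W \<le> 2 * k * t" using W(2)
      by (intro le_trans[OF W(2)] mult_le_mono2) simp
    then have cW: "real (card W) \<le> 2 * k * t"
      using of_nat_mono[of "card W" "2 * k * t", where 'a = real] by simp
    have finW: "finite W" using W(1) fin finite_subset by blast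
    have "real (card (E \<inter> Pow (V - A))) \<le>
        real (card (E \<inter> Pow (V - A - W))) + (\<Sum>x\<in>W. real (card (nbrs E x \<inter> (V - A))))"
      using of_nat_mono[OF edges_split[OF finW, of "V - A"], where 'a = real] by simp
    moreover have "(\<Sum>x\<in>W. real (card (nbrs E x \<inter> (V - A)))) \<le> (\<Sum>x\<in>W. \<delta> * n)"
    proof (rule sum_mono)
      fix x assume "x \<in> W"
      then have "\<not> \<delta> * n \<le> card (nbrs E x)" using W(1) unfolding A_def by blast
      moreover have "card (nbrs E x \<inter> (V - A)) \<le> card (nbrs E x)"
        using finite_nbrs by (intro card_mono) auto
      ultimately show "real (card (nbrs E x \<inter> (V - A))) \<le> \<delta> * n" by linarith
    qed
    moreover have "(\<Sum>x\<in>W. \<delta> * n) \<le> 2 * k * t * (\<delta> * n)"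
      using mult_right_mono[OF cW, of "\<delta> * n"] \<delta>0 by simp
    moreover have "real (card (E \<inter> Pow (V - A - W))) \<le> \<sigma> * card (V - A - W)"
    proof (rule sparse)
      show "\<not> spans_cycle E (2 * k) C" if "C \<subseteq> V - A - W" for C
        using W(4) that spans_cycle_nonempty[of E "2 * k" C] k by auto
    qed blast
    moreover have "\<sigma> * card (V - A - W) \<le> \<sigma> * n"
    proof (rule mult_left_mono[OF _ \<sigma>0])
      show "real (card (V - A - W)) \<le> real n"
        using card_mono[of V "V - A - W"] finite_V n by auto
    qed
    ultimately show ?thesis by linarith
  qed
  have D_ge: "real k * (t * real n) - t * real n / 128 \<le> D"
  proof -
    have "s * N \<le> card E" using many unfolding Ns(1) choose_2_add by linarith
    moreover have "k * t \<le> s" using Ns(2) k by (simp add: algebra_simps)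
    ultimately have "k * t * N \<le> card E" by (meson le_trans mult_le_mono1)
    then have 1: "real k * t * N \<le> card E"
      using of_nat_mono[of "k * t * N" "card E", where 'a = real] by simp
    have "E \<inter> Pow V = E" using E_sub by (auto simp: nsets_def)
    then have "card E \<le> card (E \<inter> Pow (V - A)) + (\<Sum>x\<in>A. card (nbrs E x \<inter> V))"
      using edges_split[OF A(2), of V] by simp
    also have "(\<Sum>x\<in>A. card (nbrs E x \<inter> V)) \<le> (\<Sum>x\<in>A. card (nbrs E x))"
      using finite_nbrs by (intro sum_mono card_mono) auto
    finally have "real (card E) \<le> real (card (E \<inter> Pow (V - A))) + D"
      unfolding D_def
      using of_nat_mono[of "card E" "card (E \<inter> Pow (V - A)) + (\<Sum>x\<in>A. card (nbrs E x))", where 'a = real]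
      by simp
    then have 2: "real (card E) \<le> \<sigma> * n + 2 * k * t * (\<delta> * n) + D" using outside by linarith
    have 3: "\<sigma> * n \<le> 2 * \<epsilon> * t * n" using \<sigma> by (intro mult_right_mono) auto
    have 4: "2 * k * t * (\<delta> * n) = t * real n / 384" unfolding \<delta> using k0 by simp
    have "s + 1 \<le> 2 * k * t + 1"
    proof -
      have "k \<le> k * t" using t0 by (cases t) simp_all
      moreover have "s + 1 = k * t + k" using Ns(2) by simp
      moreover have "2 * k * t = k * t + k * t" by simp
      ultimately show ?thesis by linarith
    qed
    then have "n \<le> N + 2 * k * t" using Ns(1) by simp
    then have "real n \<le> N + 2 * k * t"
      using of_nat_mono[of n "N + 2 * k * t", where 'a = real] by simp
    then have "real k * t * n \<le> real k * t * (N + 2 * k * t)"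
      by (intro mult_left_mono) auto
    moreover have "2 * (real k)\<^sup>2 * t * t \<le> 2 * (real k)\<^sup>2 * t * (\<epsilon> * n)"
      using t by (intro mult_left_mono) auto
    ultimately have 5: "real k * (t * real n) \<le> real k * t * N + 2 * (real k)\<^sup>2 * t * (\<epsilon> * n)"
      by (simp add: algebra_simps power2_eq_square)
    have "(2 * (real k)\<^sup>2 + 2) * \<epsilon> * (t * real n) \<le> 1 / 256 * (t * real n)"
      using \<epsilon> by (intro mult_right_mono) auto
    then have 6: "2 * (real k)\<^sup>2 * t * (\<epsilon> * n) + 2 * \<epsilon> * t * n \<le> t * real n / 256"
      by (simp add: algebra_simps)
    have "0 \<le> t * real n" by simp
    then show ?thesis using 1 2 3 4 5 6 by linarith
  qed
  have tc': "128 * (real k + c) \<le> t"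
    using of_nat_mono[OF tc, where 'a = real] by simp
  have cardA': "real (card A) \<le> real k * t + t / 128"
  proof -
    have "card A \<le> k * t + (k + c)" using cardA by (simp add: algebra_simps)
    then have "real (card A) \<le> real k * t + (real k + c)"
      using of_nat_mono[of "card A" "k * t + (k + c)", where 'a = real] by simp
    moreover have "real k + c \<le> t / 128" using tc' by simp
    ultimately show ?thesis by simp
  qed
  have defect: "(\<Sum>v\<in>A. real n - card (nbrs E v)) \<le> real t * real n / 64"
  proof -
    have "(\<Sum>v\<in>A. real n - card (nbrs E v)) = card A * real n - D"
      unfolding D_def by (simp add: sum_subtractf)
    also have "\<dots> \<le> (real k * t + t / 128) * n - D"
      using cardA' by (simp add: mult_right_mono)
    also have "\<dots> \<le> (real k * t + t / 128) * n - (real k * (t * real n) - t * real n / 128)" using D_ge by simp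
    also have "\<dots> = t * real n / 64" by (simp add: algebra_simps)
    finally show ?thesis .
  qed
  have pos: "0 \<le> real n - card (nbrs E v)" for v using card_nbrs_le[of v] n by simp
  show 2: "(\<Sum>a\<in>A'. real n - card (nbrs E a)) \<le> real t * real n / 64"
    using sum_mono2[OF A(2) A'A, of "\<lambda>a. real n - card (nbrs E a)"] pos defect by simp
  \<comment> \<open>Each vertex of \<open>A - A'\<close> accounts for \<open>n/4\<close> of the total defect.\<close>
  have b: "real (card (A - A')) \<le> t / 16"
  proof -
    have "real (card (A - A')) * (n / 4) = (\<Sum>v\<in>A - A'. real n / 4)" by simp
    also have "\<dots> \<le> (\<Sum>v\<in>A - A'. real n - card (nbrs E v))"
    proof (rule sum_mono)
      fix v assume "v \<in> A - A'"
      then have "\<not> 3 * n \<le> 4 * card (nbrs E v)" using A(1) unfolding A'_def by blast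
      then show "real n / 4 \<le> real n - card (nbrs E v)" by simp
    qed
    also have "\<dots> \<le> (\<Sum>v\<in>A. real n - card (nbrs E v))"
      using pos A(2) by (intro sum_mono2) auto
    also have "\<dots> \<le> t / 16 * (n / 4)" using defect by simp
    finally show ?thesis using n0 by simp
  qed
  have "D \<le> card A * real n"
    unfolding D_def using sum_mono[of A "\<lambda>v. real (card (nbrs E v))" "\<lambda>_. real n"] pos by simp
  then have "(real k * t - t / 128) * real n \<le> card A * real n" using D_ge by (simp add: algebra_simps)
  then have "real k * t - t / 128 \<le> card A" using n0 by simp
  moreover have "card A = card A' + card (A - A')"
    using A'A A(2) by (metis card_Diff_subset card_mono finite_subset le_add_diff_inverse)
  moreover have "real s + 1 = real k * t + k"
  proof -
    have "real (s + 1) = real (k * (t + 1))" using Ns(2) by simp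
    then show ?thesis by (simp add: algebra_simps)
  qed
  ultimately show "real s + 1 \<le> card A' + t / 4" using b tc' by simp
qed

section \<open>The exact bound for nearly extremal graphs\<close>

text \<open>The \<open>m\<close> savings give \<open>m\<close> cycles that use at most \<open>(k-1)m\<close> vertices of \<open>A\<close>. The other vertices of \<open>A\<close>, at least
\<open>k(M-m)\<close> of them, give the remaining cycles with any \<open>k\<close> of them at a time.\<close>

lemma cycles_from_savings:
  assumes k: "3 \<le> k" and A: "A \<subseteq> V" and "L \<inter> A = {}" "L \<subseteq> V"
    and adj: "\<And>u v. u \<in> A \<Longrightarrow> v \<in> A \<Longrightarrow> g \<le> card (nbrs E u \<inter> nbrs E v)"
    and common: "\<And>u v. u \<in> L \<Longrightarrow> v \<in> L \<Longrightarrow> k * m \<le> card (nbrs E u \<inter> nbrs E v \<inter> A)"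
    and pack: "packing (saving E k L) (V - A) m"
    and "m \<le> M" "k * M \<le> card A + m" "3 * k * m \<le> card L" "card A + 2 * k * m + k * M \<le> g"
  shows "packing (spans_cycle E (2 * k)) V M"
proof -
  have finA: "finite A" and finL: "finite L" using assms(2,4) finite_V finite_subset by blast+
  have k2: "2 \<le> k" using k by simp
  have "\<exists>W\<subseteq>V - A. finite W \<and> card W \<le> 2 * k * m \<and> packing (saving E k L) W m"
    by (rule packing_support[OF pack]) (rule saving_card[OF k2])
  then obtain W where W: "W \<subseteq> V - A" "finite W" "card W \<le> 2 * k * m" "packing (saving E k L) W m"
    by (elim exE conjE)
  have "k * m \<le> card (L - W)"
    using diff_card_le_card_Diff[OF W(2), of L] W(3) assms(10) by simp
  then obtain R where R: "R \<subseteq> L - W" "card R = k * m" "finite R"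
    using obtain_subset_with_card_n by metis
  have "\<exists>B\<subseteq>A. card B \<le> (k - 1) * m \<and> packing (spans_cycle E (2 * k)) (W \<union> B \<union> R) m"
    by (rule savings_to_cycles[OF k W(4) R(3)]) (use R W assms(3) finA common in auto)
  then obtain B where B: "B \<subseteq> A" "card B \<le> (k - 1) * m" "packing (spans_cycle E (2 * k)) (W \<union> B \<union> R) m"
    by (elim exE conjE)
  have finB: "finite B" using B(1) finA finite_subset by blast
  define Z where "Z = A \<union> W \<union> R"
  have "packing (spans_cycle E (2 * k)) ((A - B) \<union> (V - Z)) (M - m)"
  proof (rule greedy_packing[where c = k and g = g])
    show "0 < k" using k by simp
    show "nbrs E u \<subseteq> V" for u using nbrs_sub[of u] by blast
    show "\<exists>K\<subseteq>T. card K = k \<and> (\<forall>u\<in>K. \<forall>v\<in>K. g \<le> card (nbrs E u \<inter> nbrs E v))"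
      if "T \<subseteq> A - B" "card T = k" for T
      using that adj by (intro exI[of _ T]) blast
    show "A - B \<subseteq> Z" "finite Z" unfolding Z_def using finA W(2) R(3) by auto
    have "card A - card B \<le> card (A - B)" using diff_card_le_card_Diff[OF finB] .
    moreover have "(k - 1) * m + m = k * m" using k by (cases k) simp_all
    moreover have "k * (M - m) + k * m = k * M" using assms(8)
      by (metis add_mult_distrib2 le_add_diff_inverse2)
    ultimately show "k * (M - m) + k \<le> card (A - B) + k" using B(2) assms(9) by linarith
    have "card Z \<le> card A + card W + card R"
      unfolding Z_def using card_Un_le[of "A \<union> W" R] card_Un_le[of A W] by linarith
    moreover have "k * (M - m) + k * m = k * M" using assms(8)
      by (metis add_mult_distrib2 le_add_diff_inverse2)
    ultimately show "card Z + k * (M - m) \<le> g" using W(3) R(2) assms(11) by linarith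
  qed
  moreover have "(W \<union> B \<union> R) \<inter> ((A - B) \<union> (V - Z)) = {}"
    unfolding Z_def using W(1) R(1) B(1) assms(3) by blast
  ultimately have "packing (spans_cycle E (2 * k)) ((W \<union> B \<union> R) \<union> ((A - B) \<union> (V - Z))) (m + (M - m))"
    by (rule packing_add[OF B(3)])
  then have "packing (spans_cycle E (2 * k)) ((W \<union> B \<union> R) \<union> ((A - B) \<union> (V - Z))) M"
    using assms(8) by simp
  then show ?thesis
    by (rule packing_mono) (use W(1) B(1) R(1) A assms(4) in blast)
qed

text \<open>Here \<open>a = card A = s - r\<close>, \<open>U\<close> is the complement of \<open>A\<close>, \<open>L\<close> consists of the vertices of \<open>U\<close> adjacent to
more than three quarters of \<open>A\<close>, so that any two of them share more than half of \<open>A\<close>, and \<open>F\<close> is the set of bad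
vertices. The set \<open>Q\<close> of vertices with at least \<open>n/4k\<close> neighbours in \<open>U\<close> provides \<open>card Q\<close> savings by itself.
If a maximal packing of savings in \<open>U - Q\<close> has \<open>j\<close> members, then \<open>j + card Q \<le> r\<close>, and the edges are
counted in layers: at \<open>A\<close>, at \<open>Q\<close>, at the packing, and in the rest. Compared with the extremal graph, which
has \<open>r\<close> more vertices of full degree, each of the \<open>j\<close> savings accounts for at most
\<open>2k * n/4k = n/2 \<le> N\<close> edges, so that one vertex of full degree pays for it. The bad vertices pay for
themselves by the pairs that they miss in \<open>A\<close>.\<close>

lemma edge_bound_near_extremal:
  fixes \<sigma> :: real
  assumes k: "3 \<le> k" and n: "card V = n" and nopack: "\<not> packing (spans_cycle E (2 * k)) V (t + 1)"
    and Ns: "n = N + s" "s + 1 = k * (t + 1)"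
    and sparse: "\<And>S. S \<subseteq> V \<Longrightarrow> (\<And>C. C \<subseteq> S \<Longrightarrow> \<not> spans_cycle E (2 * k) C) \<Longrightarrow>
        real (card (E \<inter> Pow S)) \<le> \<sigma> * card S"
    and \<sigma>: "0 \<le> \<sigma>" "\<sigma> \<le> t / 8" and t: "4 \<le> t" and nt: "16 * k * k * t \<le> n"
    and A_def: "A = {v \<in> V. 3 * n \<le> 4 * card (nbrs E v)}"
    and A_large: "real s + 1 \<le> card A + t / 4"
    and defect: "(\<Sum>a\<in>A. real n - card (nbrs E a)) \<le> real t * real n / 64"
  shows "card E + (N choose 2) \<le> (n choose 2) + 1"
proof -
  define a where "a = card A"
  have A: "A \<subseteq> V" "finite A" unfolding A_def using finite_V by auto
  have k0: "0 < real k" and t0: "0 < real t" using k t by auto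
  \<comment> \<open>\<open>p\<close>, and \<open>y\<close> below, abbreviate products so that the estimates become linear.\<close>
  define p where "p = k * t"
  have kt: "12 \<le> p" unfolding p_def using mult_le_mono[OF k t] by simp
  have k4: "4 * k \<le> p" unfolding p_def using t by simp
  have kkt: "k * p \<ge> 3 * p" using k by simp
  have "16 * (k * p) \<le> n" unfolding p_def using nt by (simp add: mult.assoc)
  then have "16 * (3 * p) \<le> n" using mult_le_mono2[OF kkt, of 16] by (rule order_trans[rotated])
  then have nt': "48 * p \<le> n" by simp
  have adj: "n div 2 \<le> card (nbrs E u \<inter> nbrs E v)" if "u \<in> A" "v \<in> A" for u v
  proof -
    have "card (nbrs E u) + card (nbrs E v) = card (nbrs E u \<union> nbrs E v) + card (nbrs E u \<inter> nbrs E v)"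
      using card_Un_Int[OF finite_nbrs finite_nbrs] .
    moreover have "card (nbrs E u \<union> nbrs E v) \<le> n"
      unfolding n[symmetric] using nbrs_sub by (intro card_mono finite_V) blast
    ultimately show ?thesis using that unfolding A_def by auto
  qed
  have a_le: "a \<le> s"
  proof (rule ccontr)
    assume "\<not> a \<le> s"
    then have "k * (t + 1) \<le> card A" unfolding a_def using Ns(2) by simp
    then obtain B where B: "B \<subseteq> A" "card B = k * (t + 1)" "finite B"
      using obtain_subset_with_card_n by metis
    have "packing (spans_cycle E (2 * k)) (B \<union> (V - B)) (t + 1)"
    proof (rule greedy_packing[where c = k and g = "n div 2"])
      show "\<exists>K\<subseteq>T. card K = k \<and> (\<forall>u\<in>K. \<forall>v\<in>K. n div 2 \<le> card (nbrs E u \<inter> nbrs E v))"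
        if "T \<subseteq> B" "card T = k" for T
        using that adj B(1) by (intro exI[of _ T]) blast
      have "4 * p + 4 * k \<le> n" using nt' k4 kt by linarith
      then have "4 * (k * (t + 1)) \<le> n" unfolding p_def by simp
      then show "card B + k * (t + 1) \<le> n div 2" using B(2) by linarith
      show "nbrs E u \<subseteq> V" for u using nbrs_sub[of u] by blast
    qed (use k B in auto)
    then have "packing (spans_cycle E (2 * k)) V (t + 1)"
      by (rule packing_mono) (use B A in blast)
    then show False using nopack by blast
  qed
  define r where "r = s - a"
  have ar: "a + r = s" unfolding r_def using a_le by simp
  have "4 * real r + 4 \<le> t" using A_large of_nat_add[of a r, where 'a = real] ar unfolding a_def by simp
  then have r4: "4 * (r + 1) \<le> t" by simp
  define y where "y = k * (r + 1)"
  have ar': "a + r + 1 = p + k" using ar Ns(2) unfolding p_def by simp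
  have kr: "4 * y \<le> p" using mult_le_mono2[OF r4, of k] unfolding p_def y_def by (simp add: algebra_simps)
  have rk: "3 * r + 3 \<le> y" unfolding y_def using mult_le_mono1[OF k, of "r + 1"] by simp
  have a_ge: "p \<le> 2 * a" using ar' kr rk k by linarith
  have a_kr: "2 * y \<le> a" using ar' kr rk by linarith
  define U where "U = V - A"
  have U: "U \<subseteq> V" "finite U" unfolding U_def using finite_V by auto
  have cardU: "card U = N + r"
    unfolding U_def using A finite_V by (simp add: card_Diff_subset n Ns(1) flip: a_def) (use ar in simp)
  define L where "L = {u \<in> U. 4 * card (A - nbrs E u) < a}"
  define F where "F = U - L"
  have L: "L \<subseteq> U" and F: "F \<subseteq> U" "finite F" unfolding L_def F_def using U by auto
  have common: "y \<le> card (nbrs E u \<inter> nbrs E v \<inter> A)" if uv: "u \<in> L" "v \<in> L" for u v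
  proof -
    have "A \<subseteq> (nbrs E u \<inter> nbrs E v \<inter> A) \<union> ((A - nbrs E u) \<union> (A - nbrs E v))" by blast
    then have "a \<le> card ((nbrs E u \<inter> nbrs E v \<inter> A) \<union> ((A - nbrs E u) \<union> (A - nbrs E v)))"
      unfolding a_def using A(2) by (intro card_mono) auto
    also have "\<dots> \<le> card (nbrs E u \<inter> nbrs E v \<inter> A) + (card (A - nbrs E u) + card (A - nbrs E v))"
      by (meson add_left_mono card_Un_le le_trans)
    finally show ?thesis using uv a_kr unfolding L_def by auto
  qed
  \<comment> \<open>The pairs missing between \<open>F\<close> and \<open>A\<close>, counted from \<open>F\<close> and then from \<open>A\<close>.\<close>
  define miss where "miss = (\<Sum>u\<in>F. card (A - nbrs E u))"
  have miss_ge: "card F * a \<le> 4 * miss"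
  proof -
    have "(\<Sum>u\<in>F. a) \<le> (\<Sum>u\<in>F. 4 * card (A - nbrs E u))"
      by (rule sum_mono) (auto simp: F_def L_def)
    then show ?thesis unfolding miss_def by (simp add: sum_distrib_left)
  qed
  have miss_le: "real miss \<le> real t * real n / 64"
  proof -
    have 1: "card (A - nbrs E u) = (\<Sum>x\<in>A. if u \<in> nbrs E x then 0 else 1)" for u
      using A(2) by (simp add: sum.If_cases nbrs_sym[of u]) (simp add: set_diff_eq Int_def)
    have 2: "(\<Sum>u\<in>F. if u \<in> nbrs E x then 0 else 1) = card (F - nbrs E x)" for x
      using F(2) by (simp add: sum.If_cases) (simp add: set_diff_eq Int_def)
    have "miss = (\<Sum>x\<in>A. card (F - nbrs E x))"
      unfolding miss_def 1 by (subst sum.swap) (simp only: 2)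
    then have "real miss = (\<Sum>x\<in>A. real (card (F - nbrs E x)))" by simp
    also have "\<dots> \<le> (\<Sum>x\<in>A. real n - card (nbrs E x))"
    proof (rule sum_mono)
      fix x
      have "card (F - nbrs E x) \<le> card (V - nbrs E x)"
        using F(1) U(1) finite_V by (intro card_mono) auto
      also have "card (V - nbrs E x) = n - card (nbrs E x)"
        using nbrs_sub[of x] finite_nbrs n by (subst card_Diff_subset) auto
      finally show "real (card (F - nbrs E x)) \<le> real n - card (nbrs E x)"
        using card_nbrs_le[of x] n by simp
    qed
    finally show ?thesis using defect by linarith
  qed
  \<comment> \<open>Every bad vertex misses a quarter of \<open>A\<close>, but \<open>A\<close> has few missing pairs altogether.\<close>
  have F_small: "8 * k * card F \<le> n"
  proof -
    have "real (card F) * (real k * real t) \<le> real (card F) * (2 * real a)"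
      using of_nat_mono[OF a_ge, where 'a = real] unfolding p_def by (intro mult_left_mono) auto
    also have "\<dots> \<le> 8 * real miss" using of_nat_mono[OF miss_ge, where 'a = real] by (simp add: mult.commute)
    also have "\<dots> \<le> real t * real n / 8" using miss_le by simp
    finally have "real t * (8 * real k * real (card F)) \<le> real t * real n" by (simp add: mult_ac)
    then have "8 * real k * real (card F) \<le> real n" using t0 by simp
    then have "real (8 * k * card F) \<le> real n" by simp
    then show ?thesis by (simp only: of_nat_le_iff)
  qed
  have cardL: "card L + card F = N + r"
    unfolding F_def using L U(2) finite_subset cardU
    by (metis card_Diff_subset card_mono le_add_diff_inverse)
  have few_savings: False if "packing (saving E k L) U (r + 1)"
  proof -
    have "packing (spans_cycle E (2 * k)) V (t + 1)"
    proof (rule cycles_from_savings[OF k A(1) _ _ adj common[unfolded y_def] that[unfolded U_def]])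
      show "L \<inter> A = {}" "L \<subseteq> V" using L unfolding U_def by auto
      show "r + 1 \<le> t + 1" using r4 by simp
      show "k * (t + 1) \<le> card A + (r + 1)" using ar' unfolding a_def p_def by simp
      have "24 * card F \<le> 8 * k * card F" using k by simp
      then have 1: "24 * card F \<le> n" using F_small by linarith
      have "3 * y \<le> card L" using cardL 1 kr nt' k4 Ns(1) ar' ar kt by linarith
      then show "3 * k * (r + 1) \<le> card L" unfolding y_def by (simp only: mult.assoc)
      have "a + 2 * y + (p + k) \<le> n div 2" using nt' ar' kr rk k4 kt by linarith
      then show "card A + 2 * k * (r + 1) + k * (t + 1) \<le> n div 2"
        unfolding y_def p_def a_def by (simp add: algebra_simps)
    qed
    then show False using nopack by blast
  qed
  define Q where "Q = {v \<in> U. n \<le> 4 * k * card (nbrs E v \<inter> U)}"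
  have Q: "Q \<subseteq> U" "finite Q" unfolding Q_def using U(2) by auto
  have k2: "2 \<le> k" using k by simp
  have "\<exists>j W. W \<subseteq> U - Q \<and> card W \<le> 2 * k * j \<and> packing (saving E k L) W j \<and>
      \<not> (\<exists>C. saving E k L C \<and> C \<noteq> {} \<and> C \<subseteq> U - Q - W)"
    by (rule packing_maximal) (use U(2) saving_card[OF k2] in auto)
  then obtain j W where W: "W \<subseteq> U - Q" "card W \<le> 2 * k * j" "packing (saving E k L) W j"
      "\<not> (\<exists>C. saving E k L C \<and> C \<noteq> {} \<and> C \<subseteq> U - Q - W)"
    by (elim exE conjE)
  have finW: "finite W" using W(1) U(2) finite_subset by blast
  \<comment> \<open>Stars at \<open>Q\<close> and the packing in \<open>U - Q\<close> can be chosen disjoint; \<open>j'\<close> and \<open>Q'\<close> keep the occupied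
    part small.\<close>
  have jq: "j + card Q \<le> r"
  proof (rule ccontr)
    assume "\<not> j + card Q \<le> r"
    define j' where "j' = min j (r + 1)"
    have j': "j' \<le> j" "r + 1 - j' \<le> card Q" "j' \<le> r + 1"
      unfolding j'_def using \<open>\<not> j + card Q \<le> r\<close> by auto
    have "\<exists>W'\<subseteq>W. finite W' \<and> card W' \<le> 2 * k * j' \<and> packing (saving E k L) W' j'"
      by (rule packing_support[OF packing_fewer[OF W(3) j'(1)]]) (rule saving_card[OF k2])
    then obtain W' where W': "W' \<subseteq> W" "finite W'" "card W' \<le> 2 * k * j'" "packing (saving E k L) W' j'"
      by (elim exE conjE)
    obtain Q' where Q': "Q' \<subseteq> Q" "card Q' = r + 1 - j'" "finite Q'"
      using obtain_subset_with_card_n[OF j'(2)] by metis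
    have "packing (linkable E L) (Q' \<union> (U - (Q' \<union> W'))) (card Q')"
    proof (rule stars_packing)
      fix v assume "v \<in> Q'"
      then have "n \<le> 4 * k * card (nbrs E v \<inter> U)" using Q'(1) unfolding Q_def by blast
      moreover have "card (nbrs E v \<inter> U) \<le> card (nbrs E v \<inter> L \<inter> U) + card F"
      proof -
        have "nbrs E v \<inter> U \<subseteq> (nbrs E v \<inter> L \<inter> U) \<union> F" unfolding F_def by blast
        then have "card (nbrs E v \<inter> U) \<le> card ((nbrs E v \<inter> L \<inter> U) \<union> F)"
          using F(2) finite_nbrs by (intro card_mono) auto
        then show ?thesis using card_Un_le le_trans by blast
      qed
      ultimately have "n \<le> 4 * k * (card (nbrs E v \<inter> L \<inter> U) + card F)"
        by (meson le_trans mult_le_mono2)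
      then have "n \<le> 4 * k * card (nbrs E v \<inter> L \<inter> U) + 4 * k * card F"
        by (simp add: add_mult_distrib2)
      moreover have "2 * (4 * k * card F) \<le> n" using F_small by simp
      ultimately have half: "n \<le> 2 * (4 * k * card (nbrs E v \<inter> L \<inter> U))" by linarith
      have "card (Q' \<union> W') + 2 * card Q' \<le> card W' + 3 * card Q'"
        using card_Un_le[of Q' W'] by linarith
      also have "\<dots> \<le> 2 * k * j' + 3 * (r + 1 - j')" using W'(3) Q'(2) by simp
      also have "\<dots> \<le> 2 * k * j' + 2 * k * (r + 1 - j')"
        using k by (intro add_left_mono mult_le_mono1) simp
      also have "\<dots> = 2 * y" unfolding y_def using j'(3)
        by (metis add_mult_distrib2 le_add_diff_inverse mult.assoc)
      also have "\<dots> \<le> p" using kr by simp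
      also have "p \<le> card (nbrs E v \<inter> L \<inter> U)"
      proof -
        have "8 * k * p \<le> 16 * k * p" by (intro mult_le_mono1) simp
        also have "\<dots> \<le> n" unfolding p_def using nt by (simp add: mult.assoc)
        also note half
        finally have "8 * k * p \<le> 8 * k * card (nbrs E v \<inter> L \<inter> U)" by simp
        then show ?thesis using k by simp
      qed
      finally show "card (Q' \<union> W') + 2 * card Q' \<le> card (nbrs E v \<inter> L \<inter> U)" .
    qed (use Q' W' in auto)
    then have "packing (saving E k L) (Q' \<union> (U - (Q' \<union> W'))) (card Q')"
      by (rule packing_weaken) (simp add: saving_def)
    moreover have "W' \<inter> (Q' \<union> (U - (Q' \<union> W'))) = {}" using W(1) W'(1) Q'(1) by blast
    ultimately have "packing (saving E k L) (W' \<union> (Q' \<union> (U - (Q' \<union> W')))) (j' + card Q')"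
      by (rule packing_add[OF W'(4)])
    then have "packing (saving E k L) U (j' + card Q')"
      by (rule packing_mono) (use W(1) W'(1) Q'(1) Q(1) in blast)
    then show False using few_savings Q'(2) j'(3) by simp
  qed
  have bound_rest: "real (card (E \<inter> Pow (U - Q - W))) \<le> 1 + (1 + \<sigma>) * card F"
  proof -
    have "real (card (E \<inter> Pow (U - Q - W))) \<le> 1 + (1 + \<sigma>) * card (U - Q - W - L)"
    proof (rule edges_without_saving[OF _ _ sparse])
      show "U - Q - W \<subseteq> V" using U(1) by blast
      fix C assume C: "saving E k L C" "C \<subseteq> U - Q - W"
      have "C \<noteq> {}" using saving_nonempty[OF C(1)] k by simp
      then show False using W(4) C by metis
    qed
    also have "\<dots> \<le> 1 + (1 + \<sigma>) * card F"
    proof -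
      have "card (U - Q - W - L) \<le> card F" unfolding F_def using U(2) by (intro card_mono) auto
      then show ?thesis using \<sigma>(1) by (intro add_left_mono mult_left_mono) auto
    qed
    finally show ?thesis .
  qed
  have bound_W: "2 * (\<Sum>x\<in>W. card (nbrs E x \<inter> (U - Q))) \<le> j * n"
  proof -
    have "4 * k * (\<Sum>x\<in>W. card (nbrs E x \<inter> (U - Q))) = (\<Sum>x\<in>W. 4 * k * card (nbrs E x \<inter> (U - Q)))"
      by (simp add: sum_distrib_left)
    also have "\<dots> \<le> (\<Sum>x\<in>W. n)"
    proof (rule sum_mono)
      fix x assume "x \<in> W"
      then have "4 * k * card (nbrs E x \<inter> U) \<le> n" using W(1) unfolding Q_def by auto
      moreover have "card (nbrs E x \<inter> (U - Q)) \<le> card (nbrs E x \<inter> U)"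
        using finite_nbrs by (intro card_mono) auto
      ultimately show "4 * k * card (nbrs E x \<inter> (U - Q)) \<le> n"
        by (meson le_trans mult_le_mono2)
    qed
    also have "\<dots> \<le> 2 * k * j * n" using W(2) by simp
    finally have "2 * k * (2 * (\<Sum>x\<in>W. card (nbrs E x \<inter> (U - Q)))) \<le> 2 * k * (j * n)"
      by (simp add: mult_ac)
    then show ?thesis using k by simp
  qed
  have bound_UQ: "card (E \<inter> Pow (U - Q)) \<le> card (E \<inter> Pow (U - Q - W)) + (\<Sum>x\<in>W. card (nbrs E x \<inter> (U - Q)))"
    using edges_split[OF finW] .
  \<comment> \<open>The number of vertices of full degree by which \<open>A \<union> Q\<close> falls short of the extremal graph.\<close>
  define x where "x = r - card Q"
  have x: "card Q + x = r" "j \<le> x" unfolding x_def using jq by auto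
  have cardUQ: "card (U - Q) = N + x"
    using Q cardU x by (simp add: card_Diff_subset)
  have bound_U: "card (E \<inter> Pow U) + ((N + x) choose 2) \<le> ((N + r) choose 2) + card (E \<inter> Pow (U - Q))"
    using edges_plus_missing[OF U(1), of "U - Q" "{}"] cardU cardUQ by auto
  define M where "M = (\<lambda>(u, v). {u, v}) ` (SIGMA u:F. A - nbrs E u)"
  have disj: "F \<inter> A = {}" using F(1) unfolding U_def by blast
  have "inj_on (\<lambda>(u, v). {u, v}) (SIGMA u:F. A - nbrs E u)"
    using disj by (intro inj_onI) (auto simp: doubleton_eq_iff)
  then have cardM: "card M = miss"
    unfolding M_def miss_def using F(2) A(2) by (simp add: card_image)
  have bound_V: "card E + miss + ((N + r) choose 2) \<le> (n choose 2) + card (E \<inter> Pow U)"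
  proof -
    have "M \<subseteq> [V]\<^bsup>2\<^esup> - [U]\<^bsup>2\<^esup>"
      unfolding M_def using F(1) U(1) A(1) disj by (auto simp: U_def)
    moreover have "M \<inter> E = {}" unfolding M_def nbrs_def by auto
    moreover have "E \<inter> Pow V = E" using E_sub by (auto simp: nsets_def)
    ultimately show ?thesis
      using edges_plus_missing[OF order_refl U(1), of M] cardM cardU n by simp
  qed
  \<comment> \<open>The edges at bad vertices in the rest are fewer than the missing pairs between \<open>F\<close> and \<open>A\<close>.\<close>
  have bad_paid: "(1 + \<sigma>) * card F \<le> real miss"
  proof -
    have "3 * t \<le> p" unfolding p_def using k by simp
    then have "3 * t \<le> 2 * a" using a_ge by linarith
    then have "3 * real t \<le> 2 * real a"
      using of_nat_mono[of "3 * t" "2 * a", where 'a = real] by simp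
    moreover have "4 \<le> real t" using t by simp
    ultimately have "4 + 4 * \<sigma> \<le> real a" using \<sigma>(2) by linarith
    then have "4 * (1 + \<sigma>) \<le> real a" by simp
    then have "4 * (1 + \<sigma>) * card F \<le> real a * card F" by (intro mult_right_mono) auto
    then show ?thesis using of_nat_mono[OF miss_ge, where 'a = real] by (simp add: algebra_simps)
  qed
  have "n \<le> 2 * N" using nt' ar' ar k4 kt Ns(1) by linarith
  then have "j * n \<le> j * (2 * N)" by simp
  also have "\<dots> \<le> x * (2 * N)" using x(2) by (rule mult_le_mono1)
  finally have "j * n \<le> 2 * (x * N)" by simp
  then have "(\<Sum>x\<in>W. card (nbrs E x \<inter> (U - Q))) \<le> x * N" using bound_W by linarith
  then have "card E + miss + (N choose 2) \<le> (n choose 2) + card (E \<inter> Pow (U - Q - W))"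
    using bound_V bound_U bound_UQ unfolding choose_2_add[of N x] by linarith
  then have "real (card E) + real miss + real (N choose 2)
      \<le> real (n choose 2) + real (card (E \<inter> Pow (U - Q - W)))"
    by (metis of_nat_add of_nat_le_iff)
  then have "real (card E + (N choose 2)) \<le> real ((n choose 2) + 1)"
    using bound_rest bad_paid by simp
  then show ?thesis by (simp only: of_nat_le_iff)
qed

end

section \<open>Sparsity of cycle-free graphs\<close>

lemma finite_ex_set:
  "finite {card (edges G) | G :: nat graph.
     simple_graph G \<and> card (verts G) = n \<and> \<not> contains_copy G F}"
proof (rule finite_subset)
  show "{card (edges G) | G :: nat graph.
     simple_graph G \<and> card (verts G) = n \<and> \<not> contains_copy G F} \<subseteq> {..n choose 2}"
  proof clarsimp
    fix V :: "nat set" and E assume *: "simple_graph (V, E)"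
    have "card E \<le> card ([V]\<^bsup>2\<^esup>)"
      using * by (intro card_mono) (auto simp: simple_graph_def finite_imp_finite_nsets)
    then show "card E \<le> card V choose 2" by simp
  qed
qed simp

lemma ex_number_ge:
  fixes V :: "nat set"
  assumes "fin_graph V E" "card V = n" "\<not> contains_copy (V, E) F"
  shows "card E \<le> ex_number n F"
  unfolding ex_number_def
  by (rule Max_ge[OF finite_ex_set])
    (use assms in \<open>auto simp: fin_graph_def simple_graph_def intro!: exI[of _ V] exI[of _ E]\<close>)

lemma ex_number_eqI:
  fixes V :: "nat set"
  assumes "fin_graph V E" "card V = n" "\<not> contains_copy (V, E) F" "card E = m"
    and "\<And>(V' :: nat set) E'. fin_graph V' E' \<Longrightarrow> card V' = n \<Longrightarrow> \<not> contains_copy (V', E') F \<Longrightarrow> card E' \<le> m"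
  shows "ex_number n F = m"
  unfolding ex_number_def
proof (rule Max_eqI[OF finite_ex_set])
  show "m \<in> {card (edges G) | G :: nat graph.
     simple_graph G \<and> card (verts G) = n \<and> \<not> contains_copy G F}"
    using assms(1-4) by (auto simp: fin_graph_def simple_graph_def intro!: exI[of _ V] exI[of _ E])
next
  fix x assume "x \<in> {card (edges G) | G :: nat graph.
     simple_graph G \<and> card (verts G) = n \<and> \<not> contains_copy G F}"
  then show "x \<le> m"
    using assms(5) by (auto simp: fin_graph_def simple_graph_def)
qed

text \<open>Disjoint copies of the graph induced on \<open>S\<close>, as many as fit on \<open>n\<close> vertices. Copy \<open>i\<close> occupies the interval of
numbers with quotient \<open>i\<close> modulo \<open>d = card S\<close>. The quotient is constant along a cycle, so a cycle lies in one
copy and projects by \<open>\<pi>\<close> to a cycle in \<open>S\<close>.\<close>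

lemma blow_up_cycle_free:
  fixes S :: "nat set"
  assumes "fin_graph V E" "S \<subseteq> V" "S \<noteq> {}" "0 < l" "\<And>C. C \<subseteq> S \<Longrightarrow> \<not> spans_cycle E l C"
  shows "(n div card S) * card (E \<inter> Pow S) \<le> ex_number n (cycle_graph l)"
proof -
  interpret fin_graph V E by fact
  define d where "d = card S"
  define m where "m = n div d"
  have finS: "finite S" using assms(2) finite_V finite_subset by blast
  have d0: "0 < d" unfolding d_def using assms(3) finS by (simp add: card_gt_0_iff)
  obtain \<phi> where \<phi>: "bij_betw \<phi> {..<d} S"
    using ex_bij_betw_nat_finite[OF finS] unfolding d_def by (auto simp: atLeast0LessThan)
  define \<psi> where "\<psi> = the_inv_into {..<d} \<phi>"
  have \<psi>: "\<phi> (\<psi> x) = x" "\<psi> x < d" if "x \<in> S" for x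
    using that \<phi> f_the_inv_into_f_bij_betw[OF \<phi>] bij_betw_apply[OF bij_betw_the_inv_into[OF \<phi>]]
    unfolding \<psi>_def by auto
  define \<pi> where "\<pi> = (\<lambda>u. \<phi> (u mod d))"
  define h where "h = (\<lambda>(i, e). (\<lambda>x. d * i + \<psi> x) ` e)"
  define E' where "E' = h ` ({..<m} \<times> (E \<inter> Pow S))"
  have undo: "\<pi> (d * i + \<psi> x) = x" "(d * i + \<psi> x) div d = i" if "x \<in> S" for i x
    unfolding \<pi>_def using \<psi>[OF that] d0 by simp_all
  have undo_e: "\<pi> ` h (i, e) = e" if "e \<subseteq> S" for i e
  proof -
    have "\<pi> ` h (i, e) = (\<lambda>x. \<pi> (d * i + \<psi> x)) ` e" unfolding h_def by (simp add: image_image)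
    also have "\<dots> = (\<lambda>x. x) ` e" using undo(1) that by (intro image_cong) auto
    finally show ?thesis by simp
  qed
  have inj: "inj_on h ({..<m} \<times> (E \<inter> Pow S))"
  proof (rule inj_onI, clarsimp)
    fix i e j e' assume *: "e \<in> E" "e \<subseteq> S" "e' \<in> E" "e' \<subseteq> S" "h (i, e) = h (j, e')"
    then have ee: "e = e'" using undo_e by metis
    obtain x where x: "x \<in> e" using edgeE[OF *(1)] by blast
    then have "d * i + \<psi> x \<in> h (j, e')" using *(5) unfolding h_def by auto
    then obtain y where "y \<in> e'" "d * i + \<psi> x = d * j + \<psi> y" unfolding h_def by auto
    then have "i = j" using undo(2)[of x i] undo(2)[of y j] x * by auto
    then show "i = j \<and> e = e'" using ee by simp
  qed
  have md: "d * i + \<psi> x < n" if "i < m" "x \<in> S" for i x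
  proof -
    have "d * i + \<psi> x < d * (i + 1)" using \<psi>(2)[OF that(2)] by simp
    also have "\<dots> \<le> d * m" using that(1) by (intro mult_le_mono2) simp
    also have "\<dots> \<le> n" unfolding m_def by simp
    finally show ?thesis .
  qed
  have edge: "{\<pi> u, \<pi> v} \<in> E \<and> u div d = v div d \<and> \<pi> u \<in> S" if uv: "{u, v} \<in> E'" for u v
  proof -
    obtain i e where e: "{u, v} = h (i, e)" "e \<in> E" "e \<subseteq> S" using uv unfolding E'_def by auto
    have "{\<pi> u, \<pi> v} = \<pi> ` {u, v}" by simp
    also have "\<dots> = e" unfolding e(1) by (rule undo_e[OF e(3)])
    finally have "{\<pi> u, \<pi> v} = e" .
    moreover have "\<forall>w\<in>h (i, e). w div d = i"
      unfolding h_def using undo(2) e(3) by auto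
    then have "u div d = i" "v div d = i" unfolding e(1)[symmetric] by simp_all
    ultimately show ?thesis using e(2,3) by auto
  qed
  have graph: "fin_graph {..<n} E'"
  proof
    show "E' \<subseteq> [{..<n}]\<^bsup>2\<^esup>"
    proof
      fix e' assume "e' \<in> E'"
      then obtain i e where e: "e' = h (i, e)" "i < m" "e \<in> E" "e \<subseteq> S" unfolding E'_def by auto
      from e(3) obtain x y where xy: "e = {x, y}" "x \<noteq> y" by (elim edgeE)
      have "x \<in> S" "y \<in> S" using e(4) xy by auto
      then have "\<psi> x \<noteq> \<psi> y" using \<psi>(1) xy(2) by metis
      then show "e' \<in> [{..<n}]\<^bsup>2\<^esup>"
        unfolding e(1) h_def xy(1) using md e(2) \<open>x \<in> S\<close> \<open>y \<in> S\<close> by simp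
    qed
  qed simp
  have "\<not> contains_copy ({..<n}, E') (cycle_graph l)"
  proof
    assume "contains_copy ({..<n}, E') (cycle_graph l)"
    then obtain C f where f: "bij_betw f {..<l} C" "\<forall>i<l. {f i, f (Suc i mod l)} \<in> E'"
      unfolding contains_cycle_iff spans_cycle_def by blast
    have same: "f i div d = f 0 div d" if "i < l" for i
      using that
    proof (induction i)
      case (Suc i)
      have "{f i, f (Suc i mod l)} \<in> E'" using f(2) Suc_lessD[OF Suc.prems] by blast
      then have "{f i, f (Suc i)} \<in> E'" using Suc.prems by (simp only: mod_less)
      then show ?case using edge[of "f i" "f (Suc i)"] Suc by simp
    qed simp
    have "inj_on (\<pi> \<circ> f) {..<l}"
    proof (rule inj_onI)
      fix i j assume ij: "i \<in> {..<l}" "j \<in> {..<l}" "(\<pi> \<circ> f) i = (\<pi> \<circ> f) j"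
      have "f i mod d = f j mod d"
        by (rule inj_onD[OF bij_betw_imp_inj_on[OF \<phi>]]) (use ij(3) d0 in \<open>simp_all add: \<pi>_def\<close>)
      moreover have "f i div d = f j div d" using same[of i] same[of j] ij(1,2) by (simp only: lessThan_iff)
      ultimately have "f i = f j" by (metis div_mult_mod_eq)
      then show "i = j" using inj_onD[OF bij_betw_imp_inj_on[OF f(1)]] ij(1,2) by blast
    qed
    then have "spans_cycle E l ((\<pi> \<circ> f) ` {..<l})"
      unfolding spans_cycle_def using f(2) edge
      by (intro exI[of _ "\<pi> \<circ> f"]) (auto simp: bij_betw_def)
    moreover have "(\<pi> \<circ> f) ` {..<l} \<subseteq> S" using f(2) edge by auto
    ultimately show False using assms(5) by blast
  qed
  then have "card E' \<le> ex_number n (cycle_graph l)"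
    by (intro ex_number_ge[OF graph]) auto
  moreover have "card E' = m * card (E \<inter> Pow S)"
    unfolding E'_def using card_image[OF inj] by (simp add: card_cartesian_product)
  ultimately show ?thesis unfolding m_def d_def by simp
qed

text \<open>At least \<open>n / 2d\<close> copies fit, so the edge density per vertex of a cycle-free graph on \<open>d \<le> n\<close> vertices
exceeds that of the extremal graph on \<open>n\<close> vertices by a factor of at most 2.\<close>

lemma cycle_free_sparse:
  fixes S :: "nat set"
  assumes "fin_graph V E" "card V = n" "S \<subseteq> V" "0 < l" "\<And>C. C \<subseteq> S \<Longrightarrow> \<not> spans_cycle E l C"
  shows "real (card (E \<inter> Pow S)) \<le> 2 * real (ex_number n (cycle_graph l)) / n * card S"
proof (cases "S = {}")
  case True
  have "E \<inter> Pow S = {}" unfolding True using assms(1) by (auto simp: fin_graph_def nsets_def)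
  then show ?thesis using True by simp
next
  case False
  interpret fin_graph V E by fact
  define d where "d = card S"
  have "finite S" using assms(3) finite_V finite_subset by blast
  then have d: "0 < d" "d \<le> n"
    unfolding d_def using False card_mono[OF finite_V assms(3)] assms(2) by (auto simp: card_gt_0_iff)
  have "1 \<le> n div d" using d by (simp add: div_greater_zero_iff Suc_leI)
  have "n \<le> 2 * (n div d * d)"
  proof -
    have "n = n div d * d + n mod d" by simp
    moreover have "n mod d < d" using d by simp
    moreover have "d \<le> n div d * d" using \<open>1 \<le> n div d\<close> by simp
    ultimately show ?thesis by linarith
  qed
  then have "n * card (E \<inter> Pow S) \<le> 2 * (n div d * d) * card (E \<inter> Pow S)" by (rule mult_le_mono1)
  also have "\<dots> = 2 * d * (n div d * card (E \<inter> Pow S))" by simp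
  also have "\<dots> \<le> 2 * d * ex_number n (cycle_graph l)"
    using blow_up_cycle_free[OF assms(1,3) False assms(4,5), of n] unfolding d_def by (intro mult_le_mono2) auto
  finally have "real (n * card (E \<inter> Pow S)) \<le> real (2 * d * ex_number n (cycle_graph l))"
    by (rule of_nat_mono)
  then show ?thesis using d unfolding d_def[symmetric] by (simp add: field_simps)
qed

section \<open>The extremal graph\<close>

lemma packing_intersections:
  assumes "packing P W m" "finite S" "\<And>C. P C \<Longrightarrow> k \<le> card (C \<inter> S)"
  shows "k * m \<le> card (W \<inter> S)"
  using assms(1)
proof (induction m arbitrary: W)
  case (Suc m)
  from Suc.prems obtain C T where C: "P C" "C \<subseteq> W" "T \<subseteq> W" "C \<inter> T = {}" "packing P T m"
    by (elim packing_SucE)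
  have "card (C \<inter> S) + card (T \<inter> S) = card ((C \<inter> S) \<union> (T \<inter> S))"
    using C(4) assms(2) by (intro card_Un_disjoint[symmetric]) auto
  also have "\<dots> \<le> card (W \<inter> S)" using C(2,3) assms(2) by (intro card_mono) auto
  finally show ?case using assms(3)[OF C(1)] Suc.IH[OF C(5)] by simp
qed simp

text \<open>At most one edge of the cycle misses \<open>S\<close>, and each vertex of \<open>S\<close> lies on two edges of the cycle, so
\<open>2k - 1 \<le> 2 card (C \<inter> S)\<close>. In the code \<open>I\<close> and \<open>I'\<close> index the edges whose first and second
vertex lies in \<open>S\<close>, and \<open>B\<close> those that miss \<open>S\<close>.\<close>

lemma cycle_meets_cover:
  assumes "spans_cycle E (2 * k) C" "2 \<le> k" "\<And>e. e \<in> E \<Longrightarrow> e \<inter> S = {} \<Longrightarrow> e = e0"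
  shows "k \<le> card (C \<inter> S)"
proof -
  define l where "l = 2 * k"
  have l: "3 \<le> l" unfolding l_def using assms(2) by simp
  obtain f where f: "bij_betw f {..<l} C" "\<forall>i<l. {f i, f (Suc i mod l)} \<in> E"
    using assms(1) unfolding spans_cycle_def l_def by blast
  define I where "I = {i. i < l \<and> f i \<in> S}"
  define I' where "I' = {i. i < l \<and> f (Suc i mod l) \<in> S}"
  define B where "B = {i. i < l \<and> f i \<notin> S \<and> f (Suc i mod l) \<notin> S}"
  have fin: "finite I" "finite I'" "finite B" unfolding I_def I'_def B_def by auto
  have nx: "Suc i mod l < l" for i using l by simp
  have finj: "i = j" if "i < l" "j < l" "f i = f j" for i j
    using f(1) that unfolding bij_betw_def inj_on_def by auto
  have cardI: "card I = card (C \<inter> S)"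
  proof -
    have "f ` I = C \<inter> S" unfolding I_def using f(1) by (auto simp: bij_betw_def)
    moreover have "inj_on f I" unfolding I_def inj_on_def using finj by auto
    ultimately show ?thesis using card_image by fastforce
  qed
  have "card I' \<le> card I"
  proof (rule card_inj_on_le[where f = "\<lambda>i. Suc i mod l"])
    show "inj_on (\<lambda>i. Suc i mod l) I'"
      unfolding I'_def by (rule inj_onI) (auto simp: mod_Suc split: if_splits)
  qed (use fin nx in \<open>auto simp: I_def I'_def\<close>)
  moreover have "card B \<le> 1"
  proof -
    have "i = j" if "i \<in> B" "j \<in> B" for i j
    proof (rule ccontr)
      assume "i \<noteq> j"
      have ij: "i < l" "j < l" using that unfolding B_def by auto
      have "{f i, f (Suc i mod l)} = e0" "{f j, f (Suc j mod l)} = e0"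
        using that f(2) unfolding B_def by (auto intro!: assms(3))
      then have "{f i, f (Suc i mod l)} = {f j, f (Suc j mod l)}" by simp
      then have "f i = f (Suc j mod l)" "f j = f (Suc i mod l)"
        using finj[OF ij] \<open>i \<noteq> j\<close> by (auto simp: doubleton_eq_iff)
      then have "i = Suc j mod l" "j = Suc i mod l" using finj ij nx by auto
      moreover have "Suc i mod l = (if Suc i = l then 0 else Suc i)" "Suc j mod l = (if Suc j = l then 0 else Suc j)"
        using ij by (simp_all add: mod_Suc)
      ultimately have "i = (if Suc j = l then 0 else Suc j)" "j = (if Suc i = l then 0 else Suc i)" by metis+
      then show False using l ij by (simp only: split: if_split_asm)
    qed
    then show ?thesis using card_le_Suc0_iff_eq[OF fin(3)] by auto
  qed
  moreover have "l \<le> card I + card I' + card B"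
  proof -
    have "{..<l} = I \<union> I' \<union> B" unfolding I_def I'_def B_def by auto
    then show ?thesis
      using card_Un_le[of "I \<union> I'" B] card_Un_le[of I I'] by (metis add_le_mono1 card_lessThan le_trans)
  qed
  ultimately show ?thesis using cardI unfolding l_def by linarith
qed

lemma extremal_graph:
  assumes k: "2 \<le> k" and s: "s + 1 = k * (t + 1)" and n: "s + 2 \<le> n"
  obtains E where "fin_graph {..<n} E" "card E + ((n - s) choose 2) = (n choose 2) + 1"
    "\<not> packing (spans_cycle E (2 * k)) {..<n} (t + 1)"
proof
  define E where "E = insert {s, Suc s} ([{..<n}]\<^bsup>2\<^esup> - [{s..<n}]\<^bsup>2\<^esup>)"
  show "fin_graph {..<n} E"
    by standard (use n in \<open>auto simp: E_def\<close>)
  have sub: "[{s..<n}]\<^bsup>2\<^esup> \<subseteq> [{..<n}]\<^bsup>2\<^esup>" by (rule nsets_mono) auto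
  have fin: "finite ([{..<n}]\<^bsup>2\<^esup>)" by (simp add: finite_imp_finite_nsets)
  have "{s, Suc s} \<in> [{s..<n}]\<^bsup>2\<^esup>" using n by simp
  then have "card E = Suc (card ([{..<n}]\<^bsup>2\<^esup> - [{s..<n}]\<^bsup>2\<^esup>))"
    unfolding E_def using fin by simp
  also have "card ([{..<n}]\<^bsup>2\<^esup> - [{s..<n}]\<^bsup>2\<^esup>) = (n choose 2) - ((n - s) choose 2)"
    using sub fin finite_subset by (subst card_Diff_subset) auto
  finally show "card E + ((n - s) choose 2) = (n choose 2) + 1"
    using card_mono[OF fin sub] by simp
  show "\<not> packing (spans_cycle E (2 * k)) {..<n} (t + 1)"
  proof
    assume "packing (spans_cycle E (2 * k)) {..<n} (t + 1)"
    then have "k * (t + 1) \<le> card ({..<n} \<inter> {..<s})"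
    proof (rule packing_intersections)
      fix C assume "spans_cycle E (2 * k) C"
      then show "k \<le> card (C \<inter> {..<s})"
      proof (rule cycle_meets_cover[OF _ k])
        fix e assume e: "e \<in> E" "e \<inter> {..<s} = {}"
        show "e = {s, Suc s}"
        proof (rule ccontr)
          assume "e \<noteq> {s, Suc s}"
          then have e': "e \<in> [{..<n}]\<^bsup>2\<^esup>" "e \<notin> [{s..<n}]\<^bsup>2\<^esup>" using e(1) unfolding E_def by auto
          have "e \<subseteq> {..<n}" using e'(1) by (simp add: nsets_def)
          moreover have "{s..<n} = {..<n} - {..<s}" by auto
          ultimately have "e \<subseteq> {s..<n}" using e(2) by blast
          then show False using e' by (simp add: nsets_def)
        qed
      qed
    qed simp
    also have "\<dots> \<le> s" using card_mono[of "{..<s}" "{..<n} \<inter> {..<s}"] by simp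
    finally show False using s by simp
  qed
qed

section \<open>The theorem\<close>

lemma epsilon_small:
  fixes \<epsilon> :: real and n :: nat
  assumes "0 < k" "\<epsilon> = 1 / (3072 * (real k * real k) * 2 ^ (c + 1))" "real t \<le> \<epsilon> * n"
  shows "\<epsilon> * (3072 * (real k * k)) \<le> 1" "3072 * (real k * k) * t \<le> n"
proof -
  have "\<epsilon> * (3072 * (real k * k)) = 1 / 2 ^ (c + 1)" unfolding assms(2) using assms(1) by simp
  also have "\<dots> \<le> 1" using one_le_power[of "2 :: real" "c + 1"] by (simp only: divide_le_eq_1_pos zero_less_power zero_less_numeral one_le_numeral)
  finally show *: "\<epsilon> * (3072 * (real k * k)) \<le> 1" .
  have "3072 * (real k * k) * t \<le> 3072 * (real k * k) * (\<epsilon> * n)"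
    using assms(3) by (intro mult_left_mono) auto
  also have "\<dots> = \<epsilon> * (3072 * (real k * k)) * n" by simp
  also have "\<dots> \<le> 1 * real n" using * by (intro mult_right_mono) auto
  finally show "3072 * (real k * k) * t \<le> n" by simp
qed

text \<open>The choice of constants. With \<open>\<delta> = 1/768k\<close> the value \<open>c = 1536k\<^sup>2\<close> makes \<open>\<delta>c = 2k\<close>, as the double
counting in \<open>popular_subset\<close> needs. The number of common neighbours found there is about
\<open>\<delta>n / 2 ^ (c + 1)\<close>, which has to exceed the \<open>4kt\<close> vertices that the greedy packing may occupy; this
dictates \<open>\<epsilon> = \<delta> / (4k * 2 ^ (c + 1))\<close>.\<close>

lemma edge_bound:
  fixes V :: "nat set" and \<epsilon> :: real
  assumes G: "fin_graph V E" and k: "3 \<le> k" and n: "card V = n"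
    and nopack: "\<not> packing (spans_cycle E (2 * k)) V (t + 1)"
    and Ns: "n = N + s" "s + 1 = k * (t + 1)"
    and c: "c = 1536 * k * k" and \<epsilon>: "\<epsilon> = 1 / (3072 * (real k * real k) * 2 ^ (c + 1))"
    and ex: "2 * real (ex_number n (cycle_graph (2 * k))) / n \<le> 2 * \<epsilon> * t"
    and t: "real t \<le> \<epsilon> * n" "1 / (4 * \<epsilon>) \<le> t"
  shows "card E + (N choose 2) \<le> (n choose 2) + 1"
proof (cases "(n choose 2) \<le> card E + (N choose 2)")
  case True
  interpret fin_graph V E by fact
  define \<sigma> where "\<sigma> = 2 * real (ex_number n (cycle_graph (2 * k))) / n"
  define P :: real where "P = 2 ^ (c + 1)"
  have sparse: "real (card (E \<inter> Pow S)) \<le> \<sigma> * card S"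
    if "S \<subseteq> V" "\<And>C. C \<subseteq> S \<Longrightarrow> \<not> spans_cycle E (2 * k) C" for S
    unfolding \<sigma>_def by (rule cycle_free_sparse[OF G n that(1)]) (use that(2) k in auto)
  have \<sigma>: "0 \<le> \<sigma>" "\<sigma> \<le> 2 * \<epsilon> * t" using ex unfolding \<sigma>_def by auto
  have K: "3 \<le> real k" "9 \<le> real k * k"
    using k mult_mono[of 3 "real k" 3 "real k"] by auto
  have "c + 1 \<le> 2 ^ (c + 1)" by (rule less_imp_le[OF less_exp])
  then have P: "real c + 1 \<le> P" "0 < P"
    unfolding P_def using of_nat_mono[of "c + 1" "2 ^ (c + 1)", where 'a = real] by auto
  have \<epsilon>': "\<epsilon> * (3072 * (real k * k) * P) = 1" "0 < \<epsilon>"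
    unfolding \<epsilon> P_def using K by simp_all
  have \<epsilon>1: "\<epsilon> * (3072 * (real k * k)) \<le> 1" "3072 * (real k * k) * t \<le> n"
    using epsilon_small[OF _ \<epsilon> t(1)] k by simp_all
  have t': "768 * (real k * k) * P \<le> t"
  proof -
    have "1 / (4 * \<epsilon>) = 768 * (real k * k) * P"
      unfolding \<epsilon> P_def by simp
    then show ?thesis using t(2) by simp
  qed
  have tc: "128 * (real k + c) \<le> t"
  proof -
    have "128 * (real k + c) \<le> 128 * (real k * (real c + 1))"
      using K(1) by (simp add: distrib_left mult_le_cancel_right1)
    also have "\<dots> \<le> 768 * (real k * k) * (real c + 1)"
      using mult_right_mono[of "128 * real k" "768 * (real k * k)" "real c + 1"] K(1)
      by (simp add: mult.assoc)
    also have "\<dots> \<le> 768 * (real k * k) * P" using P(1) by (intro mult_left_mono) auto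
    finally show ?thesis using t' by simp
  qed
  have t0: "0 < real t" using tc K by simp
  have n0: "0 < real n"
  proof (rule ccontr)
    assume "\<not> 0 < real n"
    then show False using t(1) t0 by simp
  qed
  define A where "A = {v \<in> V. 3 * n \<le> 4 * card (nbrs E v)}"
  have "(2 * (real k)\<^sup>2 + 2) * \<epsilon> \<le> 12 * (real k * k) * \<epsilon>"
    using K \<epsilon>'(2) by (intro mult_right_mono) (auto simp: power2_eq_square)
  then have f1: "(2 * (real k)\<^sup>2 + 2) * \<epsilon> \<le> 1 / 256" using \<epsilon>1(1) by (simp add: algebra_simps)
  have f2: "2 * real k \<le> 1 / (768 * real k) * real c" unfolding c using k by simp
  have f3: "128 * (k + c) \<le> t" using tc of_nat_le_iff[of "128 * (k + c)" t, where 'a = real] by simp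
  have f4: "real (2 * k * (t + 1) + c) * 2 ^ (c + 1) < 1 / (768 * real k) * real n"
  proof -
    have "real (2 * k * (t + 1) + c) \<le> 2 * k * real t + real t"
      using tc by (simp add: algebra_simps)
    also have "\<dots> < 4 * k * real t" using K(1) t0 by (simp add: algebra_simps)
    also have "\<dots> \<le> 4 * k * (\<epsilon> * n)" using t(1) by (intro mult_left_mono) auto
    finally have "real (2 * k * (t + 1) + c) * P < 4 * k * (\<epsilon> * n) * P"
      using P(2) by (intro mult_strict_right_mono)
    also have "4 * k * (\<epsilon> * n) * P = 1 / (768 * real k) * real n"
      unfolding \<epsilon> P_def[symmetric] using P(2) k by (simp add: field_simps)
    finally show ?thesis unfolding P_def .
  qed
  note high = high_degree_vertices[OF k n nopack Ns True sparse \<sigma> t(1) f1 refl f2 f3 f4, folded A_def]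
  have "\<sigma> \<le> t / 8"
  proof -
    have "\<epsilon> * (3072 * 9) \<le> \<epsilon> * (3072 * (real k * k))" using K(2) \<epsilon>'(2) by simp
    then have "2 * \<epsilon> * t \<le> 1 / 8 * t" using \<epsilon>1(1) by (intro mult_right_mono) auto
    then show ?thesis using \<sigma>(2) by simp
  qed
  moreover have "4 \<le> t" using tc K by simp
  moreover have "16 * k * k * t \<le> n"
  proof -
    have "16 * (real k * k) * t \<le> 3072 * (real k * k) * t" by (intro mult_right_mono) auto
    then show ?thesis
      using \<epsilon>1(2) of_nat_le_iff[of "16 * k * k * t" n, where 'a = real] by (simp add: mult.assoc)
  qed
  ultimately show ?thesis
    using edge_bound_near_extremal[OF k n nopack Ns sparse \<sigma>(1) _ _ _ A_def high] by blast
qed simp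

text \<open>Sparsity applied to a single edge. It turns the lower end of the range of \<open>t\<close> into a constant lower bound
\<open>1 / 4\<epsilon>\<close> for \<open>t\<close>, so that \<open>t\<close> is as large as the constants of the proof require.\<close>

lemma ex_number_even_cycle_ge:
  assumes "2 \<le> k" "2 \<le> n"
  shows "n \<le> 4 * ex_number n (cycle_graph (2 * k))"
proof -
  have G: "fin_graph {..<n} {{0, 1}}" by standard (use assms(2) in auto)
  have "\<not> spans_cycle {{0, 1}} (2 * k) C" if "C \<subseteq> {0, 1}" for C :: "nat set"
    using spans_cycle_card[of "{{0, 1}}" "2 * k" C] card_mono[of "{0, 1}" C] that assms(1) by auto
  then have "real (card ({{0, 1}} \<inter> Pow {0, 1 :: nat}))
      \<le> 2 * real (ex_number n (cycle_graph (2 * k))) / n * card {0, 1 :: nat}"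
    using assms by (intro cycle_free_sparse[OF G]) auto
  then have "real n \<le> real (4 * ex_number n (cycle_graph (2 * k)))"
    using assms(2) by (simp add: field_simps)
  then show ?thesis by (simp only: of_nat_le_iff)
qed

theorem theorem1p1:
  fixes k :: nat
  assumes "k \<ge> 3"
  shows "\<exists>\<epsilon>::real. \<epsilon> > 0 \<and> (\<exists>n0::nat. \<forall>n\<ge>n0. \<forall>t::nat.
           real (ex_number n (cycle_graph (2 * k))) / (\<epsilon> * real n) \<le> real t \<and>
           real t \<le> \<epsilon> * real n \<longrightarrow>
           real (ex_number n (disjoint_copies (t + 1) (cycle_graph (2 * k)))) =
             real (n choose 2) - ((real n - real k * (real t + 1) + 1) gchoose 2) + 1)"
proof -
  define c where "c = 1536 * k * k"
  define \<epsilon> :: real where "\<epsilon> = 1 / (3072 * (real k * real k) * 2 ^ (c + 1))"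
  have \<epsilon>0: "0 < \<epsilon>" unfolding \<epsilon>_def using assms by simp
  have "real (ex_number n (disjoint_copies (t + 1) (cycle_graph (2 * k)))) =
      real (n choose 2) - ((real n - real k * (real t + 1) + 1) gchoose 2) + 1"
    if n: "2 \<le> n" and t: "real (ex_number n (cycle_graph (2 * k))) / (\<epsilon> * real n) \<le> real t"
      "real t \<le> \<epsilon> * real n" for n t
  proof -
    define x where "x = ex_number n (cycle_graph (2 * k))"
    have n4: "n \<le> 4 * x" unfolding x_def using ex_number_even_cycle_ge[of k n] assms n by simp
    have n0: "0 < real n" using n by simp
    have xt: "real x \<le> t * (\<epsilon> * n)"
      using t(1) \<epsilon>0 n0 unfolding x_def[symmetric] by (simp add: pos_divide_le_eq)
    then have ex: "2 * real x / n \<le> 2 * \<epsilon> * t" using n0 by (simp add: pos_divide_le_eq mult_ac)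
    have "real n \<le> 4 * real x" using of_nat_mono[OF n4, where 'a = real] by simp
    then have "1 * real n \<le> (4 * (t * \<epsilon>)) * n" using xt by simp
    then have "1 \<le> 4 * (t * \<epsilon>)" using n0 by (simp only: mult_le_cancel_right_pos)
    then have t4: "1 / (4 * \<epsilon>) \<le> t" using \<epsilon>0 by (simp add: pos_divide_le_eq mult_ac)
    define s where "s = k * (t + 1) - 1"
    have s: "s + 1 = k * (t + 1)" unfolding s_def using assms by simp
    have "t \<noteq> 0" using \<open>1 \<le> 4 * (t * \<epsilon>)\<close> by (cases "t = 0") simp_all
    then have "k * 1 \<le> k * t" by (intro mult_le_mono2) simp
    moreover have "3 * (k * t) \<le> k * (k * t)" using assms by (intro mult_le_mono1)
    moreover have "3072 * (k * (k * t)) \<le> n"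
      using epsilon_small(2)[OF _ \<epsilon>_def t(2)] assms of_nat_le_iff[of "3072 * (k * (k * t))" n, where 'a = real]
      by (simp add: mult.assoc)
    moreover have "s + 1 = k * t + k" using s by simp
    ultimately have sn: "s + 2 \<le> n" using assms unfolding mult_1_right by linarith
    obtain E where E: "fin_graph {..<n} E" "card E + ((n - s) choose 2) = (n choose 2) + 1"
      "\<not> packing (spans_cycle E (2 * k)) {..<n} (t + 1)"
      using extremal_graph[OF _ s sn] assms by auto
    have iff: "contains_copy (V, E) (disjoint_copies (t + 1) (cycle_graph (2 * k))) \<longleftrightarrow>
        packing (spans_cycle E (2 * k)) V (t + 1)" for V and E :: "nat set set"
      using contains_disjoint_cycles_iff[of "2 * k"] assms by simp
    have "ex_number n (disjoint_copies (t + 1) (cycle_graph (2 * k))) = card E"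
    proof (rule ex_number_eqI[OF E(1) _ _ refl])
      show "\<not> contains_copy ({..<n}, E) (disjoint_copies (t + 1) (cycle_graph (2 * k)))"
        unfolding iff by (rule E(3))
      fix V' :: "nat set" and E' assume G: "fin_graph V' E'" "card V' = n"
        "\<not> contains_copy (V', E') (disjoint_copies (t + 1) (cycle_graph (2 * k)))"
      have "card E' + ((n - s) choose 2) \<le> (n choose 2) + 1"
        by (rule edge_bound[OF G(1) assms G(2) G(3)[unfolded iff] _ s c_def \<epsilon>_def ex[unfolded x_def] t(2) t4])
          (use sn in simp)
      then show "card E' \<le> card E" using E(2) by linarith
    qed simp
    moreover have "real n - real k * (real t + 1) + 1 = real (n - s)"
    proof -
      have "real (s + 1) = real (k * (t + 1))" unfolding s ..
      then show ?thesis using sn by (simp add: of_nat_diff algebra_simps)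
    qed
    moreover have "real (card E) + real ((n - s) choose 2) = real (n choose 2) + 1"
      using arg_cong[OF E(2), of real] by simp
    ultimately show ?thesis by (simp add: binomial_gbinomial)
  qed
  then show ?thesis using \<epsilon>0 by (intro exI[of _ \<epsilon>] conjI exI[of _ 2]) auto
qed

end
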